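(* Let $\mu,\nu\in\mathcal{P}(\mathbb{T})$. The following are equivalent: - (1) $(\mu,\nu)$ is $\rhd_c$-infinitely divisible, $\mu\ne\omega$ and $\nu\ne\omega$. - (2) There exists a weakly continuous $\rhd_c$-convolution semigroup $\{(\mu_t,\nu_t)\}_{t\ge0}$ with $(\mu_0,\nu_0)=(\delta_1,\delta_1)$ and $(\mu_1,\nu_1)=(\mu,\nu)$.
   Context: $\mathbb{T}$ is the unit circle, $\mathbb{D}$ the open unit disc, $\mathcal{P}(\mathbb{T})$ the Borel probability measures on $\mathbb{T}$, $\omega$ the normalized Haar measure, and $\delta_1$ the Dirac mass at $1$. For $\mu\in\mathcal{P}(\mathbb{T})$ let $\psi_\mu(z)=\int\frac{z\zeta}{1-z\zeta}d\mu(\zeta)$ and $\eta_\mu=\psi_\mu/(1+\psi_\mu)$ on $\mathbb{D}$; $\eta_\mu$ determines $\mu$. The multiplicative conditionally monotone convolution is $(\mu_1,\nu_1)\rhd_c(\mu_2,\nu_2)=(\mu,\nu)$ with $\eta_\nu=\eta_{\nu_1}\circ\eta_{\nu_2}$ and $\eta_\mu(z)=\eta_{\mu_2}(z)\,h_{\mu_1}(\eta_{\nu_2}(z))$, where $h_{\mu_1}(w)=\eta_{\mu_1}(w)/w$ and $h_{\mu_1}(0)=\eta_{\mu_1}'(0)$. $(\mu,\nu)$ is $\rhd_c$-infinitely divisible if for every integer $n\ge2$ there is $(\mu_n,\nu_n)\in\mathcal{P}(\mathbb{T})^2$ whose $n$-fold $\rhd_c$-power equals $(\mu,\nu)$. A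 weakly continuous $\rhd_c$-convolution semigroup is a family $\{(\mu_t,\nu_t)\}_{t\ge0}$ with $(\mu_{s+t},\nu_{s+t})=(\mu_s,\nu_s)\rhd_c(\mu_t,\nu_t)$ for all $s,t\ge0$ and $t\mapsto\mu_t,\nu_t$ weakly continuous. *)

theory Defs
  imports "HOL-Probability.Probability"
begin

definition probT :: "complex measure \<Rightarrow> bool" where
  "probT M \<longleftrightarrow> prob_space M \<and> sets M = sets (borel :: complex measure)
      \<and> emeasure M (sphere 0 1) = 1"

definition haarT :: "complex measure" where
  "haarT = distr (uniform_measure lborel {0..<2*pi}) borel cis"

definition dirac1 :: "complex measure" where
  "dirac1 = return borel 1"

definition psiT :: "complex measure \<Rightarrow> complex \<Rightarrow> complex" where
  "psiT M z = (\<integral>\<zeta>. z * \<zeta> / (1 - z * \<zeta>) \<partial>M)"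

definition etaT :: "complex measure \<Rightarrow> complex \<Rightarrow> complex" where
  "etaT M z = psiT M z / (1 + psiT M z)"

definition hT :: "complex measure \<Rightarrow> complex \<Rightarrow> complex" where
  "hT M w = (if w = 0 then deriv (etaT M) 0 else etaT M w / w)"

text \<open>Multiplicative conditionally monotone convolution, as a relation:
  cm_conv (mu1,nu1) (mu2,nu2) (mu,nu) means (mu1,nu1) |>c (mu2,nu2) = (mu,nu).
  Since eta determines the measure, this relation is functional.\<close>
definition cm_conv ::
  "complex measure \<times> complex measure \<Rightarrow> complex measure \<times> complex measure
     \<Rightarrow> complex measure \<times> complex measure \<Rightarrow> bool" where
  "cm_conv p1 p2 p \<longleftrightarrow>
     probT (fst p1) \<and> probT (snd p1) \<and> probT (fst p2) \<and> probT (snd p2)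
     \<and> probT (fst p) \<and> probT (snd p) \<and>
     (\<forall>z\<in>ball 0 1.
        etaT (snd p) z = etaT (snd p1) (etaT (snd p2) z) \<and>
        etaT (fst p) z = etaT (fst p2) z * hT (fst p1) (etaT (snd p2) z))"

inductive cm_pow ::
  "nat \<Rightarrow> complex measure \<times> complex measure \<Rightarrow> complex measure \<times> complex measure \<Rightarrow> bool"
where
  cm_pow_0: "cm_pow 0 p (dirac1, dirac1)"
| cm_pow_Suc: "cm_pow n p q \<Longrightarrow> cm_conv q p r \<Longrightarrow> cm_pow (Suc n) p r"

definition cm_inf_div :: "complex measure \<Rightarrow> complex measure \<Rightarrow> bool" where
  "cm_inf_div \<mu> \<nu> \<longleftrightarrow>
     (\<forall>n::nat. n \<ge> 2 \<longrightarrow>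
        (\<exists>\<mu>n \<nu>n. probT \<mu>n \<and> probT \<nu>n \<and> cm_pow n (\<mu>n, \<nu>n) (\<mu>, \<nu>)))"

definition weakly_continuous :: "(real \<Rightarrow> complex measure) \<Rightarrow> bool" where
  "weakly_continuous M \<longleftrightarrow>
     (\<forall>f :: complex \<Rightarrow> real. continuous_on UNIV f \<and> bounded (range f) \<longrightarrow>
        continuous_on {0..} (\<lambda>t. \<integral>x. f x \<partial>(M t)))"

definition cm_semigroup :: "(real \<Rightarrow> complex measure) \<Rightarrow> (real \<Rightarrow> complex measure) \<Rightarrow> bool" where
  "cm_semigroup \<mu>t \<nu>t \<longleftrightarrow>
     (\<forall>t\<ge>0. probT (\<mu>t t) \<and> probT (\<nu>t t)) \<and>
     (\<forall>s\<ge>0. \<forall>t\<ge>0. cm_conv (\<mu>t s, \<nu>t s) (\<mu>t t, \<nu>t t) (\<mu>t (s + t), \<nu>t (s + t))) \<and>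
     weakly_continuous \<mu>t \<and> weakly_continuous \<nu>t"

end

theory Submission
  imports Defs "HOL-Complex_Analysis.Complex_Analysis"
begin

text \<open>
  By the Herglotz representation, measures on the circle correspond to holomorphic maps \<open>p\<close> of the
  disc into the closed disc via \<open>\<eta>(z) = z p(z)\<close>. A pair \<open>(\<mu>, \<nu>)\<close> becomes a pair \<open>(h, p)\<close>, and its
  \<open>n\<close>-th power is \<open>z \<mapsto> \<Prod>k<n. h (f\<^sup>k z)\<close>, \<open>z \<mapsto> \<Prod>k<n. p (f\<^sup>k z)\<close> with \<open>f z = z p z\<close>.
  If \<open>p\<close> or \<open>h\<close> vanished at \<open>0\<close>, the Schwarz lemma applied to \<open>n\<close>-th roots would bound it by
  \<open>\<bar>z\<bar>\<^sup>n\<close> for all \<open>n\<close>, which forces the Haar measure.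

  Otherwise Dirichlet approximation yields roots \<open>(h\<^sub>j, p\<^sub>j)\<close> of orders \<open>n\<^sub>j \<rightarrow> \<infinity>\<close> with
  \<open>p\<^sub>j(0) \<rightarrow> 1\<close>, and by Schwarz--Pick \<open>p\<^sub>j\<close> and \<open>h\<^sub>j\<close> differ from their values at \<open>0\<close> by
  \<open>O(1 / n\<^sub>j)\<close>. If \<open>n\<^sub>j \<bar>p\<^sub>j(0) - 1\<bar>\<close> stays bounded along a subsequence, the powers with exponent
  \<open>\<lfloor>n\<^sub>j t\<rfloor>\<close> are equicontinuous in \<open>(t, z)\<close> and any limit is a semigroup through the given pair.
  If it is unbounded, powers of the roots approximate rotations, which then commute with the given
  pair; so \<open>p\<close> and \<open>h\<close> are constant and the semigroup is explicit.
\<close>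

section \<open>Bounded holomorphic functions on the disc and cocycles\<close>

text \<open>The obstacle is that roots are not unique. A root of order n has a multiplier whose
  modulus is the n-th root of \<open>norm (p 0)\<close>, hence within O(1/n) of 1, but nothing
  controls its argument. The two components differ here. Multiplying the h-component of a root by a
  unimodular constant only multiplies its cocycle by a power of that constant, so its argument can
  be divided out and later restored through the character \<open>cis (t * \<theta>)\<close>. The
  argument \<alpha> of the p-component changes the orbits themselves and cannot be removed this way;
  the case distinction concerns it alone. If n |\<alpha>| is large, about \<theta> / |\<alpha>|
  steps turn the disc by \<theta> while using only a small fraction of the n steps, so hardly any
  modulus is lost. For the converse, the value of h or p at 0 is the first moment and is
  multiplicative in time. Were it 0 at time 1, it would be 0 at all times 1/n, whereas weak
  continuity makes its real part tend to the first moment of \<open>dirac1\<close>, which is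
  1.\<close>

definition schur :: "(complex \<Rightarrow> complex) \<Rightarrow> bool" where
  "schur p \<longleftrightarrow> p holomorphic_on ball 0 1 \<and> (\<forall>z\<in>ball 0 1. norm (p z) \<le> 1)"

lemma schur_holo: "schur p \<Longrightarrow> p holomorphic_on ball 0 1"
  and schur_norm: "schur p \<Longrightarrow> norm z < 1 \<Longrightarrow> norm (p z) \<le> 1"
  by (auto simp: schur_def)

lemma schur_const: "norm c \<le> 1 \<Longrightarrow> schur (\<lambda>_. c)"
  by (auto simp: schur_def)

lemma schur_mult: "schur p \<Longrightarrow> schur q \<Longrightarrow> schur (\<lambda>z. p z * q z)"
  by (auto simp: schur_def norm_mult intro!: holomorphic_intros mult_le_one)

lemma schur_norm_less:
  assumes "schur p" "norm z < 1"
  shows "norm (z * p z) \<le> norm z" "norm (z * p z) < 1"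
proof -
  show "norm (z * p z) \<le> norm z"
    using schur_norm[OF assms] by (simp add: norm_mult mult_left_le)
  then show "norm (z * p z) < 1" using assms by simp
qed

text \<open>Maximum modulus principle. The unimodular constants, which belong to Dirac masses, are
  the only case without a Moebius map of the disc moving \<open>p 0\<close> to 0.\<close>

lemma schur_const_or_less_1:
  assumes "schur p"
  obtains c where "norm c \<le> 1" "\<And>z. norm z < 1 \<Longrightarrow> p z = c"
  | "\<And>z. norm z < 1 \<Longrightarrow> norm (p z) < 1"
proof (cases "\<exists>z. norm z < 1 \<and> norm (p z) \<ge> 1")
  case True
  then obtain \<xi> where \<xi>: "norm \<xi> < 1" "norm (p \<xi>) \<ge> 1" by blast
  have "p constant_on ball 0 1"
  proof (rule maximum_modulus_principle[where U = "ball 0 1" and \<xi> = \<xi>])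
    show "norm (p z) \<le> norm (p \<xi>)" if "z \<in> ball 0 1" for z
      using schur_norm[OF assms, of z] that \<xi> by simp
  qed (use \<xi> schur_holo[OF assms] in auto)
  then obtain c where c: "\<And>z. z \<in> ball 0 1 \<Longrightarrow> p z = c" by (auto simp: constant_on_def)
  then have "norm c \<le> 1" using schur_norm[OF assms, of 0] by simp
  then show ?thesis using that(1) c by auto
next
  case False
  then show ?thesis using that(2) by force
qed

text \<open>The Schwarz lemma for \<open>p\<close> followed by the Moebius map that sends
  \<open>p 0\<close> to 0. The denominator is multiplied out so that unimodular constants, for which
  it vanishes, are included.\<close>

lemma schur_Schwarz_Pick:
  assumes p: "schur p" and z: "norm z < 1"
  shows "norm (p z - p 0) \<le> norm z * norm (1 - cnj (p 0) * p z)"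
  using p
proof (cases rule: schur_const_or_less_1)
  case 1
  then have "p z = p 0" using z by simp
  then show ?thesis by simp
next
  case 2
  have p0: "norm (p 0) < 1" using 2[of 0] by simp
  let ?m = "Moebius_function 0 (p 0)"
  have "norm ((?m \<circ> p) z) \<le> norm z"
  proof (rule Schwarz_Lemma)
    show "?m \<circ> p holomorphic_on ball 0 1"
      using 2 by (intro holomorphic_on_compose_gen[OF schur_holo[OF p] Moebius_function_holomorphic[OF p0]]) auto
  qed (use 2 p0 z in \<open>auto simp: Moebius_function_eq_zero Moebius_function_norm_lt_1\<close>)
  then have *: "norm (p z - p 0) / norm (1 - cnj (p 0) * p z) \<le> norm z"
    by (simp add: Moebius_function_simple norm_divide)
  have "norm (cnj (p 0) * p z) < 1"
    using norm_mult_less[of "cnj (p 0)" 1 "p z" 1] p0 2[OF z] by simp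
  then have "norm (1 - cnj (p 0) * p z) > 0" by auto
  with * show ?thesis by (simp add: pos_divide_le_eq)
qed

lemma schur_vanishing_bound:
  assumes "schur p" "norm z < 1" "p 0 = 0"
  shows "norm (p z) \<le> norm z"
  using schur_Schwarz_Pick[OF assms(1,2)] assms(3) by simp

text \<open>Schwarz--Pick bounds the difference d by r times a quantity that itself contains d; as r
  < 1, this d can be absorbed, which produces the factor 1 / (1 - r). Combined with
  \<open>one_minus_norm_root_le\<close> the bound is O(1/n) for a root of order n.\<close>

lemma schur_diff_0_bound:
  assumes p: "schur p" and z: "norm z \<le> r" "r < 1"
  shows "norm (p z - p 0) \<le> 2 / (1 - r) * (1 - norm (p 0))"
proof -
  define d where "d = norm (p z - p 0)"
  have p0: "norm (p 0) \<le> 1" using schur_norm[OF p, of 0] by simp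
  have r0: "0 \<le> r" using z norm_ge_zero order_trans by blast
  have "1 - cnj (p 0) * p z = of_real (1 - (norm (p 0))\<^sup>2) - cnj (p 0) * (p z - p 0)"
    by (simp add: algebra_simps complex_norm_square del: of_real_power)
  then have "norm (1 - cnj (p 0) * p z) \<le> norm (of_real (1 - (norm (p 0))\<^sup>2) :: complex) + norm (cnj (p 0) * (p z - p 0))"
    using norm_triangle_ineq4 by metis
  also have "norm (of_real (1 - (norm (p 0))\<^sup>2) :: complex) = 1 - (norm (p 0))\<^sup>2"
    using p0 by (subst norm_of_real) (simp add: power_le_one)
  also have "norm (cnj (p 0) * (p z - p 0)) \<le> d"
    using p0 by (simp add: norm_mult d_def mult_left_le_one_le)
  also have "1 - (norm (p 0))\<^sup>2 = (1 + norm (p 0)) * (1 - norm (p 0))"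
    by (simp add: power2_eq_square algebra_simps)
  also have "\<dots> \<le> 2 * (1 - norm (p 0))"
    using p0 by (intro mult_right_mono) auto
  finally have *: "norm (1 - cnj (p 0) * p z) \<le> 2 * (1 - norm (p 0)) + d" by simp
  have "d \<le> norm z * norm (1 - cnj (p 0) * p z)"
    unfolding d_def using schur_Schwarz_Pick[OF p] z by simp
  also have "\<dots> \<le> r * (2 * (1 - norm (p 0)) + d)"
    using * z r0 by (intro mult_mono) auto
  finally have "d * (1 - r) \<le> r * (2 * (1 - norm (p 0)))" by (simp add: algebra_simps)
  also have "\<dots> \<le> 2 * (1 - norm (p 0))"
    using z p0 by (intro mult_left_le_one_le) (auto simp: r0)
  finally show ?thesis using z unfolding d_def by (simp add: field_simps)
qed

lemma schur_Lipschitz: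
  assumes p: "schur p" and zw: "norm z \<le> r" "norm w \<le> r" "r < 1"
  shows "norm (p z - p w) \<le> 2 / (1 - r) * norm (z - w)"
proof (rule field_differentiable_bound[where S = "cball 0 r" and f' = "deriv p"])
  fix u :: complex assume u: "u \<in> cball 0 r"
  then have u1: "u \<in> ball 0 1" using zw by auto
  show "(p has_field_derivative deriv p u) (at u within cball 0 r)"
    using holomorphic_derivI[OF schur_holo[OF p] open_ball u1] by (rule has_field_derivative_at_within)
  \<comment> \<open>Half the distance from the disc of radius r to the unit circle; Cauchy's
    estimate at this radius yields the constant 2 / (1 - r).\<close>
  define s where "s = (1 - r) / 2"
  have sub: "cball u s \<subseteq> ball 0 1"
  proof
    fix x assume "x \<in> cball u s"
    then have "dist 0 x \<le> dist 0 u + dist u x" "dist u x \<le> s" "dist 0 u \<le> r"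
      using u dist_triangle[of 0 x u] by auto
    moreover have "r + s < 1" using zw by (simp add: s_def field_simps)
    ultimately show "x \<in> ball 0 1" by simp
  qed
  have "norm ((deriv ^^ 1) p u) \<le> fact 1 * 1 / s ^ 1"
  proof (rule Cauchy_inequality)
    show "p holomorphic_on ball u s"
      using sub ball_subset_cball holomorphic_on_subset[OF schur_holo[OF p]] by blast
    show "continuous_on (cball u s) p"
      using sub holomorphic_on_imp_continuous_on holomorphic_on_subset[OF schur_holo[OF p]] by blast
    show "norm (p x) \<le> 1" if "norm (u - x) = s" for x
      using that sub schur_norm[OF p, of x] by (force simp: dist_norm)
  qed (use zw in \<open>auto simp: s_def\<close>)
  then show "norm (deriv p u) \<le> 2 / (1 - r)" by (simp add: s_def)
qed (use zw in auto)

text \<open>By Montel's theorem a subsequence has a holomorphic limit, which pointwise convergence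
  identifies with \<open>l\<close>.\<close>

lemma schur_pointwise_limit:
  assumes g: "\<And>j::nat. schur (g j)"
    and lim: "\<And>z. norm z < 1 \<Longrightarrow> (\<lambda>j. g j z) \<longlonglongrightarrow> l z"
  shows "schur l"
proof -
  obtain k r where k: "k holomorphic_on ball 0 1" "strict_mono (r::nat \<Rightarrow> nat)"
    "\<And>z. z \<in> ball 0 1 \<Longrightarrow> (\<lambda>n. g (r n) z) \<longlonglongrightarrow> k z"
  proof (rule Montel[of "ball 0 1" "Collect schur" g])
    show "\<exists>B. \<forall>h\<in>Collect schur. \<forall>z\<in>K. norm (h z) \<le> B" if "K \<subseteq> ball 0 1" for K
      using that by (auto simp: schur_def intro!: exI[of _ 1])
  qed (use g in \<open>auto simp: schur_holo\<close>)
  have "k z = l z" if "z \<in> ball 0 1" for z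
    using LIMSEQ_unique[OF k(3)[OF that]] LIMSEQ_subseq_LIMSEQ[OF lim k(2), of z] that
    by (simp add: o_def)
  with k(1) have "l holomorphic_on ball 0 1" by (rule holomorphic_transform)
  moreover have "norm (l z) \<le> 1" if "norm z < 1" for z
    using lim[OF that] tendsto_norm
    by (intro LIMSEQ_le_const2[OF tendsto_norm[OF lim[OF that]]]) (use g schur_norm that in auto)
  ultimately show ?thesis by (auto simp: schur_def)
qed

section \<open>Cocycles over the iterates of z * p z\<close>

definition cocycle :: "('a \<Rightarrow> 'a) \<Rightarrow> ('a \<Rightarrow> complex) \<Rightarrow> nat \<Rightarrow> 'a \<Rightarrow> complex" where
  "cocycle f g m z = (\<Prod>k<m. g ((f ^^ k) z))"

lemma cocycle_0 [simp]: "cocycle f g 0 z = 1"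
  by (simp add: cocycle_def)

lemma cocycle_add: "cocycle f g (a + b) z = cocycle f g b z * cocycle f g a ((f ^^ b) z)"
proof (induction a)
  case (Suc a)
  then show ?case by (simp add: cocycle_def funpow_add)
qed simp

lemma cocycle_Suc: "cocycle f g (Suc m) z = g z * cocycle f g m (f z)"
  using cocycle_add[of f g m 1] by (simp add: cocycle_def)

lemma cocycle_power: "cocycle (f ^^ q) (cocycle f g q) m z = cocycle f g (q * m) z"
proof (induction m)
  case (Suc m)
  have "cocycle (f ^^ q) (cocycle f g q) (Suc m) z =
      cocycle (f ^^ q) (cocycle f g q) m z * cocycle f g q (((f ^^ q) ^^ m) z)"
    by (simp add: cocycle_def)
  also have "\<dots> = cocycle f g (q * m) z * cocycle f g q ((f ^^ (q * m)) z)"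
    by (simp add: Suc funpow_mult mult.commute)
  also have "\<dots> = cocycle f g (q * Suc m) z"
    by (simp flip: cocycle_add)
  finally show ?case .
qed simp

lemma funpow_times: "((\<lambda>z. z * p z) ^^ m) z = z * cocycle (\<lambda>z. z * p z) p m z"
proof (induction m arbitrary: z)
  case (Suc m)
  then show ?case by (simp add: cocycle_Suc funpow_Suc_right del: funpow.simps)
qed simp

lemma schur_funpow_norm:
  assumes "schur p" "norm z < 1"
  shows "norm (((\<lambda>z. z * p z) ^^ k) z) \<le> norm z"
proof (induction k)
  case (Suc k)
  then show ?case using schur_norm_less(1)[OF assms(1), of "((\<lambda>z. z * p z) ^^ k) z"] assms(2) by simp
qed simp

lemma schur_funpow_holo:
  assumes "schur p"
  shows "((\<lambda>z. z * p z) ^^ k) holomorphic_on ball 0 1"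
proof (induction k)
  case 0
  then show ?case by (simp add: id_def)
next
  case (Suc k)
  have "(\<lambda>z. z * p z) \<circ> ((\<lambda>z. z * p z) ^^ k) holomorphic_on ball 0 1"
  proof (rule holomorphic_on_compose_gen[OF Suc])
    show "(\<lambda>z. z * p z) holomorphic_on ball 0 1"
      using schur_holo[OF assms] by (intro holomorphic_intros)
    show "((\<lambda>z. z * p z) ^^ k) ` ball 0 1 \<subseteq> ball 0 1"
      using schur_funpow_norm[OF assms] by (force intro: le_less_trans)
  qed
  then show ?case by (simp add: o_def)
qed

lemma schur_compose_funpow:
  assumes "schur p" "schur g"
  shows "schur (\<lambda>z. g (((\<lambda>z. z * p z) ^^ k) z))"
proof -
  have sub: "((\<lambda>z. z * p z) ^^ k) ` ball 0 1 \<subseteq> ball 0 1"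
    using schur_funpow_norm[OF assms(1)] by (force intro: le_less_trans)
  have "g \<circ> ((\<lambda>z. z * p z) ^^ k) holomorphic_on ball 0 1"
    using sub by (intro holomorphic_on_compose_gen[OF schur_funpow_holo[OF assms(1)] schur_holo[OF assms(2)]])
  then show ?thesis using sub assms(2) by (auto simp: schur_def o_def)
qed

lemma schur_cocycle:
  assumes "schur p" "schur g"
  shows "schur (cocycle (\<lambda>z. z * p z) g m)"
proof -
  have "schur (\<lambda>z. \<Prod>k<m. g (((\<lambda>z. z * p z) ^^ k) z))"
    by (induction m) (simp_all add: schur_const schur_mult schur_compose_funpow assms)
  then show ?thesis by (simp add: cocycle_def[abs_def])
qed

lemma funpow_times_0 [simp]: "((\<lambda>z::complex. z * p z) ^^ k) 0 = 0"
  by (induction k) auto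

lemma cocycle_at_0 [simp]: "cocycle (\<lambda>z::complex. z * p z) g m 0 = g 0 ^ m"
  by (simp add: cocycle_def)

text \<open>Telescoping: all factors are bounded by 1 and the orbit of z stays in the disc of radius
  r, so every factor contributes at most \<epsilon>.\<close>

lemma cocycle_near_power:
  assumes "schur p" "schur g" "norm c \<le> 1" "norm z \<le> r" "r < 1"
    and "\<And>w. norm w \<le> r \<Longrightarrow> norm (g w - c) \<le> \<epsilon>"
  shows "norm (cocycle (\<lambda>z. z * p z) g m z - c ^ m) \<le> real m * \<epsilon>"
proof -
  have b: "norm (((\<lambda>z. z * p z) ^^ k) z) \<le> r" for k
    using schur_funpow_norm[OF assms(1), of z k] assms by linarith
  have "norm ((\<Prod>k<m. g (((\<lambda>z. z * p z) ^^ k) z)) - (\<Prod>k<m. c)) \<le>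
      (\<Sum>k<m. norm (g (((\<lambda>z. z * p z) ^^ k) z) - c))"
    using b assms(3,5) by (intro norm_prod_diff) (auto intro!: schur_norm[OF assms(2)] intro: le_less_trans)
  also have "\<dots> \<le> (\<Sum>k<m. \<epsilon>)" by (intro sum_mono assms b)
  finally show ?thesis by (simp add: cocycle_def)
qed

section \<open>Roots\<close>

lemma norm_cis_diff_le: "norm (cis a - cis b) \<le> \<bar>a - b\<bar>"
proof -
  have "norm (iexp (a - b) - 1) \<le> \<bar>a - b\<bar>"
    using iexp_approx1[of "a - b" 0] by simp
  moreover have "cis a - cis b = cis b * (iexp (a - b) - 1)"
    by (simp add: cis_conv_exp right_diff_distrib flip: exp_add)
  ultimately show ?thesis by (simp add: norm_mult)
qed

text \<open>The argument order is opposite to that of pairs of measures: \<open>p\<close> and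
  \<open>q\<close> belong to the second component, which drives the dynamics, and \<open>h\<close>
  and \<open>g\<close> to the first.\<close>

definition is_root where
  "is_root p h n q g \<longleftrightarrow> schur q \<and> schur g \<and>
     (\<forall>z\<in>ball 0 1. cocycle (\<lambda>z. z * q z) q n z = p z \<and> cocycle (\<lambda>z. z * q z) g n z = h z)"

text \<open>The self-map attached to the k-th power of a root is the k-th iterate of z * q z, so m
  steps of it are k * m steps of the original.\<close>

lemma is_root_power:
  assumes "is_root p h (k * m) q g"
  shows "is_root p h m (cocycle (\<lambda>z. z * q z) q k) (cocycle (\<lambda>z. z * q z) g k)"
proof -
  have eq: "(\<lambda>z. z * cocycle (\<lambda>z. z * q z) q k z) = (\<lambda>z. z * q z) ^^ k"
    by (intro ext) (simp add: funpow_times)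
  show ?thesis
    using assms unfolding is_root_def eq cocycle_power by (auto intro: schur_cocycle)
qed

lemma is_root_at_0:
  assumes "is_root p h n q g"
  shows "q 0 ^ n = p 0" "g 0 ^ n = h 0"
  using assms unfolding is_root_def by (metis centre_in_ball cocycle_at_0 zero_less_one)+

text \<open>Iterates never leave the disc of radius \<open>norm z\<close>, where each factor is at
  most \<open>norm z\<close> by the Schwarz lemma.\<close>

lemma cocycle_vanishing_bound:
  assumes "schur q" "schur g" "g 0 = 0" "norm z < 1"
  shows "norm (cocycle (\<lambda>z. z * q z) g n z) \<le> norm z ^ n"
proof -
  have "norm (g (((\<lambda>z. z * q z) ^^ k) z)) \<le> norm z" for k
    using schur_vanishing_bound[OF assms(2) _ assms(3)] schur_funpow_norm[OF assms(1,4), of k] assms(4)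
    by (meson le_less_trans order_trans)
  then have "(\<Prod>k<n. norm (g (((\<lambda>z. z * q z) ^^ k) z))) \<le> (\<Prod>k<n. norm z)"
    by (intro prod_mono) auto
  then show ?thesis by (simp add: cocycle_def prod_norm)
qed

text \<open>An arbitrary \<open>u\<close> lets this serve both components; for p the factor
  \<open>g\<close> is \<open>q\<close> itself.\<close>

lemma nonzero_at_0_of_roots:
  assumes "\<And>n. 2 \<le> n \<Longrightarrow> \<exists>q g. schur q \<and> schur g \<and> (\<forall>z\<in>ball 0 1. cocycle (\<lambda>z. z * q z) g n z = u z)"
    and "norm z < 1" "u z \<noteq> 0"
  shows "u 0 \<noteq> 0"
proof
  assume u0: "u 0 = 0"
  have "norm (u z) \<le> norm z ^ n" if n: "n \<ge> 2" for n
  proof -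
    obtain q g where qg: "schur q" "schur g" "\<And>z. z \<in> ball 0 1 \<Longrightarrow> cocycle (\<lambda>z. z * q z) g n z = u z"
      using assms(1)[OF n] by blast
    have "g 0 ^ n = 0" using qg(3)[of 0] u0 by simp
    then have "g 0 = 0" by simp
    then show ?thesis using cocycle_vanishing_bound[OF qg(1,2) _ assms(2), of n] qg(3)[of z] assms(2) by simp
  qed
  then have "norm (u z) \<le> 0"
    using assms(2) by (intro LIMSEQ_le_const[OF LIMSEQ_power_zero[of "norm z"]]) auto
  then show False using assms(3) by simp
qed

text \<open>By Dirichlet's approximation theorem a small power of a root of highly divisible order
  has its multiplier close to the positive real axis, and that power is again a root of large order.\<close>
lemma is_root_small_argument:
  assumes roots: "\<And>n. 2 \<le> n \<Longrightarrow> \<exists>q g. is_root p h n q g" and j: "2 \<le> j"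
  obtains n q g \<alpha> where "j \<le> n" "is_root p h n q g" "q 0 = of_real (norm (q 0)) * cis \<alpha>"
    "\<bar>\<alpha>\<bar> \<le> 2 * pi / real j"
proof -
  \<comment> \<open>The factorial makes the order divisible by whichever k <= j the approximation
    theorem returns; the extra factor j keeps the order of the resulting power at least j.\<close>
  have "1 * 2 \<le> fact j * j" using j by (intro mult_mono) (auto simp: fact_ge_1)
  then obtain Q G where QG: "is_root p h (fact j * j) Q G" using roots[of "fact j * j"] by auto
  obtain l k where lk: "0 < k" "k \<le> int j" "\<bar>of_int k * (Arg (Q 0) / (2 * pi)) - of_int l\<bar> < 1 / real j"
    by (rule Dirichlet_approx[of j "Arg (Q 0) / (2 * pi)"]) (use j in auto)
  define k' where "k' = nat k"
  have k': "0 < k'" "k' \<le> j" "real_of_int k = real k'" using lk by (auto simp: k'_def)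
  have "k' dvd fact j" using k' by (intro dvd_fact) auto
  then obtain d where d: "fact j = k' * d" by (elim dvdE)
  have "d \<ge> 1" using d by (cases d) (auto simp: fact_nonzero)
  define \<alpha> where "\<alpha> = 2 * pi * (real k' * (Arg (Q 0) / (2 * pi)) - of_int l)"
  let ?q = "cocycle (\<lambda>z. z * Q z) Q k'" and ?g = "cocycle (\<lambda>z. z * Q z) G k'"
  have "is_root p h (d * j) ?q ?g"
    using QG by (intro is_root_power) (simp add: d mult.assoc)
  moreover have "j \<le> d * j" using \<open>d \<ge> 1\<close> by simp
  moreover have "\<bar>\<alpha>\<bar> \<le> 2 * pi / real j"
  proof -
    have "\<bar>\<alpha>\<bar> = 2 * pi * \<bar>of_int k * (Arg (Q 0) / (2 * pi)) - of_int l\<bar>"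
      unfolding \<alpha>_def k'(3) by (subst abs_mult) simp
    also have "\<dots> \<le> 2 * pi * (1 / real j)" using lk(3) by (intro mult_left_mono) auto
    finally show ?thesis by simp
  qed
  moreover have "?q 0 = of_real (norm (?q 0)) * cis \<alpha>"
  proof -
    have "\<alpha> = real k' * Arg (Q 0) - 2 * pi * of_int l" by (simp add: \<alpha>_def field_simps)
    then have "cis \<alpha> = cis (real k' * Arg (Q 0))"
      by (simp flip: cis_divide)
    then have "of_real (norm (Q 0) ^ k') * cis \<alpha> = (rcis (norm (Q 0)) (Arg (Q 0))) ^ k'"
      by (simp add: DeMoivre2) (simp add: rcis_def)
    then show ?thesis by (simp add: rcis_cmod_Arg norm_power)
  qed
  ultimately show ?thesis using that by blast
qed

section \<open>Moduli of roots, and near invariance under their powers\<close>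

lemma one_minus_norm_root_le:
  assumes "x ^ n = (y::complex)" "y \<noteq> 0" "0 < n"
  shows "1 - norm x \<le> - ln (norm y) / real n"
proof -
  have "x \<noteq> 0" using assms by auto
  then have "ln (norm x) \<le> norm x - 1" by (intro ln_le_minus_one) auto
  moreover have "ln (norm y) = real n * ln (norm x)"
    using \<open>x \<noteq> 0\<close> by (simp add: norm_power ln_realpow flip: assms(1))
  ultimately show ?thesis using assms(3) by (simp add: field_simps)
qed

text \<open>Iterates commute, so the cocycle of n + m steps factors in two ways: u(z) v(f^n z) =
  v(z) u(f^m z), with u the n-step and v the m-step cocycle. Both values of v are near g(0)^m, which
  leaves u(f^m z) near u(z). The factor \<open>norm (g 0) ^ m\<close> avoids a division.\<close>

lemma cocycle_almost_invariant:
  assumes q: "schur q" and g: "schur g" and z: "norm z \<le> r" "r < 1"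
  defines "f \<equiv> (\<lambda>z. z * q z)"
  shows "norm (cocycle f g n ((f ^^ m) z) - cocycle f g n z) * norm (g 0) ^ m
    \<le> 2 * (real m * (2 / (1 - r) * (1 - norm (g 0))))"
proof -
  define \<epsilon> where "\<epsilon> = 2 / (1 - r) * (1 - norm (g 0))"
  let ?u = "cocycle f g n" and ?v = "cocycle f g m"
  have fz: "norm ((f ^^ k) z) \<le> norm z" for k
    unfolding f_def using z by (intro schur_funpow_norm[OF q]) auto
  have near: "norm (g 0 ^ m - ?v w) \<le> real m * \<epsilon>" if "norm w \<le> r" for w
    using cocycle_near_power[OF q g _ that z(2), of "g 0" \<epsilon> m] schur_diff_0_bound[OF g _ z(2)]
      schur_norm[OF g, of 0] by (simp add: f_def \<epsilon>_def norm_minus_commute)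
  have u1: "norm (?u w) \<le> 1" if "norm w \<le> norm z" for w
    unfolding f_def using that z by (intro schur_norm[OF schur_cocycle[OF q g]]) auto
  have "?u z * ?v ((f ^^ n) z) = ?v z * ?u ((f ^^ m) z)"
    by (metis add.commute cocycle_add)
  then have "(?u ((f ^^ m) z) - ?u z) * g 0 ^ m =
      ?u ((f ^^ m) z) * (g 0 ^ m - ?v z) - ?u z * (g 0 ^ m - ?v ((f ^^ n) z))"
    by (simp add: algebra_simps)
  then have "norm (?u ((f ^^ m) z) - ?u z) * norm (g 0) ^ m \<le>
      norm (?u ((f ^^ m) z) * (g 0 ^ m - ?v z)) + norm (?u z * (g 0 ^ m - ?v ((f ^^ n) z)))"
    using norm_triangle_ineq4 by (metis norm_mult norm_power)
  also have "\<dots> \<le> 1 * (real m * \<epsilon>) + 1 * (real m * \<epsilon>)"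
    unfolding norm_mult using fz z by (intro add_mono mult_mono u1 near) (auto intro: order_trans)
  finally show ?thesis by (simp add: \<epsilon>_def)
qed

text \<open>If the arguments of the multipliers of roots of order \<open>n\<close> are large compared with \<open>1 / n\<close>,
  then suitable powers of these roots converge to arbitrary rotations. Since they commute with the
  given pair, the latter is rotation invariant.\<close>
lemma constant_of_fast_rotating_roots:
  assumes p: "schur p" "p 0 \<noteq> 0" and h: "schur h" "h 0 \<noteq> 0"
    and roots: "\<And>\<epsilon>. \<epsilon> > 0 \<Longrightarrow> \<exists>n q g \<alpha>. is_root p h n q g \<and> q 0 = of_real (norm (q 0)) * cis \<alpha> \<and>
          \<bar>\<alpha>\<bar> \<le> \<epsilon> \<and> 1 \<le> \<epsilon> * (real n * \<bar>\<alpha>\<bar>)"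
    and z: "norm z < 1"
  shows "p z = p 0" "h z = h 0"
proof -
  define M where "M = - ln (norm (p 0)) - ln (norm (h 0))"
  have l: "- ln (norm (p 0)) \<ge> 0" "- ln (norm (h 0)) \<ge> 0"
    using schur_norm[OF p(1), of 0] schur_norm[OF h(1), of 0] p(2) h(2) by auto
  have M: "M \<ge> 0" "- ln (norm (p 0)) \<le> M" "- ln (norm (h 0)) \<le> M" using l by (auto simp: M_def)
  \<comment> \<open>The roots have arguments of unknown sign, so for each \<theta> only one of the
    two rotations is reached.\<close>
  have key: "\<exists>s\<in>{1,-1}. p (cis (s * \<theta>) / 2) = p (1/2) \<and> h (cis (s * \<theta>) / 2) = h (1/2)"
    if \<theta>: "0 < \<theta>" "\<theta> \<le> 1" for \<theta> :: real
  proof -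
    define D where "D s = norm (p (cis (s * \<theta>) / 2) - p (1/2)) + norm (h (cis (s * \<theta>) / 2) - h (1/2))"
      for s :: real
    \<comment> \<open>The sign may vary with \<epsilon>; the minimum of the two defects does not
      refer to it. The constants 72 and 8 are generous, since the estimates give 52 and 4.\<close>
    have bound: "min (D 1) (D (-1)) \<le> \<epsilon> * (72 * M + 8)"
      if \<epsilon>: "\<epsilon> > 0" "\<epsilon> * M \<le> 1/2" for \<epsilon>
    proof -
      obtain n q g \<alpha> where r: "is_root p h n q g" "q 0 = of_real (norm (q 0)) * cis \<alpha>"
        "\<bar>\<alpha>\<bar> \<le> \<epsilon>" "1 \<le> \<epsilon> * (real n * \<bar>\<alpha>\<bar>)"
        using roots[OF \<epsilon>(1)] by blast
      have q: "schur q" and g: "schur g" using r(1) by (auto simp: is_root_def)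
      have n: "n > 0" and a0: "\<alpha> \<noteq> 0" using r(4) by (auto intro!: Nat.gr0I)
      \<comment> \<open>The number of steps of angle |\<alpha>| needed to turn by \<theta>; rounding
        down costs at most |\<alpha>| <= \<epsilon>.\<close>
      define m where "m = nat \<lfloor>\<theta> / \<bar>\<alpha>\<bar>\<rfloor>"
      have m1: "real m \<le> \<theta> / \<bar>\<alpha>\<bar>" using \<theta> by (simp add: m_def)
      have m2: "\<theta> / \<bar>\<alpha>\<bar> - 1 \<le> real m" using \<theta> by (simp add: m_def)
      \<comment> \<open>Here fast rotation enters: m is a small fraction of n, so by
        \<open>small\<close> the m-th power of a root loses little modulus.\<close>
      have "real m \<le> 1 / \<bar>\<alpha>\<bar>" using m1 \<theta> by (smt (verit) divide_right_mono abs_ge_zero)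
      also have "\<dots> \<le> \<epsilon> * n" using r(4) a0 by (simp add: field_simps)
      finally have mn: "real m \<le> \<epsilon> * n" .
      have small: "real m * (1 - norm x) \<le> \<epsilon> * M" "norm x ^ m \<ge> 1/2"
        if x: "x ^ n = y" "y \<noteq> 0" "- ln (norm y) \<le> M" "norm x \<le> 1" for x y :: complex
      proof -
        have "real m * (1 - norm x) \<le> \<epsilon> * n * (M / n)"
          using one_minus_norm_root_le[OF x(1,2) n] divide_right_mono[OF x(3), of "real n"] M x(4) \<epsilon>
          by (intro mult_mono mn) auto
        then show 1: "real m * (1 - norm x) \<le> \<epsilon> * M" using n by simp
        have "1 + real m * (norm x - 1) \<le> (1 + (norm x - 1)) ^ m"
          by (rule Bernoulli_inequality) (smt (verit) norm_ge_zero)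
        then show "norm x ^ m \<ge> 1/2" using 1 \<epsilon>(2) by (simp add: algebra_simps)
      qed
      have q0: "norm (q 0) \<le> 1" and g0: "norm (g 0) \<le> 1"
        using schur_norm[OF q, of 0] schur_norm[OF g, of 0] by auto
      note small_q = small[OF is_root_at_0(1)[OF r(1)] p(2) M(2) q0]
      note small_g = small[OF is_root_at_0(2)[OF r(1)] h(2) M(3) g0]
      define f where "f = (\<lambda>z. z * q z)"
      define w where "w = (f ^^ m) (1/2)"
      have inv: "norm (u w - u (1/2)) \<le> 16 * (\<epsilon> * M)"
        if k: "schur k" "\<And>z. norm z < 1 \<Longrightarrow> cocycle f k n z = u z"
          "real m * (1 - norm (k 0)) \<le> \<epsilon> * M" "norm (k 0) ^ m \<ge> 1/2" for k u
      proof -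
        have w1: "norm w < 1"
          unfolding w_def f_def using schur_funpow_norm[OF q, of "1/2" m] by simp
        have "norm (u w - u (1/2)) * (1/2) \<le> norm (u w - u (1/2)) * norm (k 0) ^ m"
          using k(4) by (intro mult_left_mono) auto
        also have "\<dots> \<le> 8 * (real m * (1 - norm (k 0)))"
          using cocycle_almost_invariant[OF q k(1), of "1/2" "1/2" n m] k(2)[OF w1] k(2)[of "1/2"]
          by (simp flip: f_def w_def add: right_diff_distrib mult_ac)
        finally show ?thesis using k(3) by simp
      qed
      have co: "cocycle f q n z = p z" "cocycle f g n z = h z" if "norm z < 1" for z
        using r(1) that by (auto simp: is_root_def f_def)
      have inv_p: "norm (p w - p (1/2)) \<le> 16 * (\<epsilon> * M)"
        using inv[OF q co(1) small_q] by simp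
      have inv_h: "norm (h w - h (1/2)) \<le> 16 * (\<epsilon> * M)"
        using inv[OF g co(2) small_g] by simp
      define s where "s = sgn \<alpha>"
      have s: "s \<in> {1,-1}" using a0 by (auto simp: s_def sgn_if)
      have "norm (cocycle f q m (1/2) - q 0 ^ m) \<le> real m * (2 / (1 - 1/2) * (1 - norm (q 0)))"
        unfolding f_def
        by (rule cocycle_near_power[OF q q q0, where r = "1/2"]) (rule schur_diff_0_bound[OF q] | simp)+
      then have 1: "norm (cocycle f q m (1/2) - q 0 ^ m) \<le> 4 * (\<epsilon> * M)"
        using small_q(1) by (simp add: right_diff_distrib)
      have qm: "q 0 ^ m = of_real (norm (q 0) ^ m) * cis (real m * \<alpha>)"
        using arg_cong[OF r(2), of "\<lambda>x. x ^ m"] by (simp only: power_mult_distrib Complex.DeMoivre of_real_power)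
      have "q 0 ^ m - cis (real m * \<alpha>) = of_real (norm (q 0) ^ m - 1) * cis (real m * \<alpha>)"
        unfolding qm by (simp add: algebra_simps)
      then have "norm (q 0 ^ m - cis (real m * \<alpha>)) = \<bar>norm (q 0) ^ m - 1\<bar>"
        by (metis mult.right_neutral norm_cis norm_mult norm_of_real)
      also have "\<dots> = 1 - norm (q 0) ^ m" using q0 by (simp add: power_le_one)
      also have "\<dots> \<le> real m * (1 - norm (q 0))"
        using Bernoulli_inequality[of "norm (q 0) - 1" m] by (simp add: algebra_simps)
      also have "\<dots> \<le> \<epsilon> * M" by (rule small_q)
      finally have 2: "norm (q 0 ^ m - cis (real m * \<alpha>)) \<le> \<epsilon> * M" .
      have sa: "\<alpha> = s * \<bar>\<alpha>\<bar>" by (simp add: s_def sgn_mult_abs)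
      have "real m * \<alpha> - s * \<theta> = s * (real m * \<bar>\<alpha>\<bar> - \<theta>)"
        by (subst sa) (simp add: algebra_simps)
      then have "\<bar>real m * \<alpha> - s * \<theta>\<bar> = \<bar>real m * \<bar>\<alpha>\<bar> - \<theta>\<bar>" using s by (auto simp: abs_mult)
      also have "\<dots> \<le> \<bar>\<alpha>\<bar>" using m1 m2 a0 by (simp add: field_simps abs_le_iff)
      finally have 3: "norm (cis (real m * \<alpha>) - cis (s * \<theta>)) \<le> \<epsilon>"
        using norm_cis_diff_le[of "real m * \<alpha>" "s * \<theta>"] r(3) by linarith
      have "norm (cocycle f q m (1/2) - cis (s * \<theta>)) \<le> 5 * (\<epsilon> * M) + \<epsilon>"
        using norm_diff_triangle_le[OF norm_diff_triangle_le[OF 1 2] 3] by (simp add: mult.commute)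
      moreover have "w - cis (s * \<theta>) / 2 = (cocycle f q m (1/2) - cis (s * \<theta>)) / 2"
        unfolding w_def f_def funpow_times by (simp add: diff_divide_distrib)
      then have "norm (w - cis (s * \<theta>) / 2) = norm (cocycle f q m (1/2) - cis (s * \<theta>)) / 2"
        by (simp only: norm_divide norm_numeral)
      ultimately have wd: "norm (w - cis (s * \<theta>) / 2) \<le> (5 * (\<epsilon> * M) + \<epsilon>) / 2" by (simp only: divide_right_mono)
      have wle: "norm w \<le> 1/2" unfolding w_def f_def using schur_funpow_norm[OF q, of "1/2" m] by simp
      have lip: "norm (u w - u (cis (s * \<theta>) / 2)) \<le> 10 * (\<epsilon> * M) + 2 * \<epsilon>" if "schur u" for u
        using schur_Lipschitz[OF that wle, of "cis (s * \<theta>) / 2"] wd by (simp add: norm_divide)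
      have tri: "norm (u (cis (s * \<theta>) / 2) - u (1/2)) \<le> 26 * (\<epsilon> * M) + 2 * \<epsilon>"
        if "schur u" "norm (u w - u (1/2)) \<le> 16 * (\<epsilon> * M)" for u
        using norm_diff_triangle_le[OF lip[OF that(1), unfolded norm_minus_commute[of "u w"]] that(2)] by (simp add: mult.commute)
      have "D s \<le> 52 * (\<epsilon> * M) + 4 * \<epsilon>"
        unfolding D_def using tri[OF p(1) inv_p] tri[OF h(1) inv_h] by linarith
      also have "\<dots> \<le> \<epsilon> * (72 * M + 8)" using \<epsilon> M by (simp add: algebra_simps)
      finally show ?thesis using s by auto
    qed
    have "min (D 1) (D (-1)) \<le> 0"
    proof (rule field_le_epsilon)
      fix e :: real assume e: "e > 0"
      define \<epsilon> where "\<epsilon> = min (1 / (2 * M + 1)) (e / (72 * M + 8))"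
      have "\<epsilon> > 0" using M e by (simp add: \<epsilon>_def)
      moreover have "\<epsilon> * M \<le> 1/2"
      proof -
        have "\<epsilon> * M \<le> 1 / (2 * M + 1) * M" using M by (intro mult_right_mono) (auto simp: \<epsilon>_def)
        also have "\<dots> \<le> 1/2" using M by (simp add: field_simps)
        finally show ?thesis .
      qed
      moreover have "\<epsilon> * (72 * M + 8) \<le> e / (72 * M + 8) * (72 * M + 8)"
        using M by (intro mult_right_mono) (auto simp: \<epsilon>_def)
      moreover have "e / (72 * M + 8) * (72 * M + 8) = e" using M by simp
      ultimately show "min (D 1) (D (-1)) \<le> 0 + e" using bound[of \<epsilon>] by linarith
    qed
    then consider "D 1 \<le> 0" | "D (-1) \<le> 0" by linarith
    then obtain s where "s \<in> {1,-1}" "D s \<le> 0" by (metis insertI1 insertI2 singletonI)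
    moreover from this have "norm (p (cis (s * \<theta>) / 2) - p (1/2)) = 0" "norm (h (cis (s * \<theta>) / 2) - h (1/2)) = 0"
      unfolding D_def by (smt (verit) norm_ge_zero)+
    ultimately show ?thesis by auto
  qed
  \<comment> \<open>As \<theta> tends to 0, the points given by \<open>key\<close> accumulate at
    1/2, and the identity theorem applies. Since \<open>key\<close> provides one sign for both
    functions, a single set serves p and h.\<close>
  define U where "U = {w\<in>ball 0 1. p w = p (1/2) \<and> h w = h (1/2)}"
  have lp: "(1/2 :: complex) islimpt U"
    unfolding islimpt_approachable
  proof (intro allI impI)
    fix e :: real assume e: "e > 0"
    define \<theta> where "\<theta> = min 1 e"
    have \<theta>: "0 < \<theta>" "\<theta> \<le> 1" "\<theta> \<le> e" using e by (auto simp: \<theta>_def)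
    obtain s where s: "s \<in> {1,-1}" "p (cis (s * \<theta>) / 2) = p (1/2)" "h (cis (s * \<theta>) / 2) = h (1/2)"
      using key[OF \<theta>(1,2)] by blast
    let ?w = "cis (s * \<theta>) / 2"
    have "?w \<in> U" using s by (simp add: U_def norm_divide)
    moreover have "sin \<theta> > 0" using \<theta> pi_gt3 by (intro sin_gt_zero) auto
    then have "?w \<noteq> 1/2" using s(1) by (auto simp: complex_eq_iff)
    moreover have "norm (?w - 1/2) = norm (cis (s * \<theta>) - cis 0) / 2"
      by (simp flip: diff_divide_distrib add: norm_divide)
    then have "dist ?w (1/2) < e"
      using norm_cis_diff_le[of "s * \<theta>" 0] s(1) \<theta> by (auto simp: dist_norm)
    ultimately show "\<exists>x'\<in>U. x' \<noteq> 1/2 \<and> dist x' (1/2) < e" by blast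
  qed
  have const: "u x = u (1/2)" if "schur u" "norm x < 1" and u: "\<And>w. w \<in> U \<Longrightarrow> u w = u (1/2)" for u x
  proof -
    have "u x - u (1/2) = 0"
    proof (rule analytic_continuation[where f = "\<lambda>x. u x - u (1/2)" and S = "ball 0 1" and U = U and \<xi> = "1/2"])
      show "(\<lambda>x. u x - u (1/2)) holomorphic_on ball 0 1"
        using schur_holo[OF that(1)] by (intro holomorphic_intros)
      show "u w - u (1/2) = 0" if "w \<in> U" for w
        using u[OF that] by (subst right_minus_eq)
    qed (use that(2) lp in \<open>auto simp: U_def\<close>)
    then show ?thesis by (subst (asm) right_minus_eq)
  qed
  have p_const: "p x = p (1/2)" and h_const: "h x = h (1/2)" if "norm x < 1" for x
    by (rule const[OF p(1) that], simp add: U_def, rule const[OF h(1) that], simp add: U_def)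
  show "p z = p 0" "h z = h 0"
    using p_const[OF z] p_const[of 0] h_const[OF z] h_const[of 0] by simp_all
qed

section \<open>Limit semigroups\<close>

text \<open>The maps z * P t z form a one-parameter semigroup of self-maps of the disc and
  \<open>H\<close> is a multiplicative cocycle over it: the continuous-time form of
  \<open>cocycle_add\<close>, with the map for t applied before that for s. Continuity in t is
  pointwise in z, as in \<open>weakly_continuous_of_etaT\<close>.\<close>

definition schur_semigroup :: "(real \<Rightarrow> complex \<Rightarrow> complex) \<Rightarrow> (real \<Rightarrow> complex \<Rightarrow> complex) \<Rightarrow> bool" where
  "schur_semigroup P H \<longleftrightarrow>
     (\<forall>t\<ge>0. schur (P t) \<and> schur (H t)) \<and>
     (\<forall>z\<in>ball 0 1. P 0 z = 1 \<and> H 0 z = 1) \<and>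
     (\<forall>s\<ge>0. \<forall>t\<ge>0. \<forall>z\<in>ball 0 1. P (s + t) z = P t z * P s (z * P t z) \<and>
                                H (s + t) z = H t z * H s (z * P t z)) \<and>
     (\<forall>z\<in>ball 0 1. continuous_on {0..} (\<lambda>t. P t z) \<and> continuous_on {0..} (\<lambda>t. H t z))"

context
  fixes q k :: "complex \<Rightarrow> complex" and N :: nat and K r :: real and z :: complex
  assumes q: "schur q" and k: "schur k" and N: "N > 0" and K: "norm (k 0 - 1) \<le> K / N"
    and z: "norm z \<le> r" and r: "r < 1"
begin

text \<open>On the disc of radius r every factor is within O(1/N) of 1: \<open>k 0\<close> is so by
  assumption, and \<open>schur_diff_0_bound\<close> controls the variation of \<open>k\<close>.
  Hence each extra step costs O(1/N). Later \<open>k\<close> is either \<open>q\<close> itself or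
  the other component of the root.\<close>

lemma cocycle_steps_diff:
  assumes "b \<le> a"
  shows "norm (cocycle (\<lambda>z. z * q z) k a z - cocycle (\<lambda>z. z * q z) k b z)
    \<le> (real a - real b) * (K * (2 / (1 - r) + 1) / N)"
proof -
  let ?f = "\<lambda>z. z * q z"
  have near: "norm (k w - 1) \<le> K * (2 / (1 - r) + 1) / N" if "norm w \<le> r" for w
  proof -
    have "1 - norm (k 0) \<le> norm (k 0 - 1)"
      by (metis norm_minus_commute norm_one norm_triangle_ineq2)
    then have "norm (k w - k 0) \<le> 2 / (1 - r) * (K / N)"
      using schur_diff_0_bound[OF k that r] r K
      by (elim order_trans) (intro mult_left_mono, auto)
    then have "norm (k w - 1) \<le> 2 / (1 - r) * (K / N) + K / N"
      using K by (rule norm_diff_triangle_le)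
    then show ?thesis by (simp add: algebra_simps add_divide_distrib)
  qed
  obtain d where d: "a = d + b" using assms by (metis le_add_diff_inverse2)
  have fz: "norm ((?f ^^ b) z) \<le> r"
    using schur_funpow_norm[OF q, of z b] z r by linarith
  have "cocycle ?f k a z - cocycle ?f k b z = cocycle ?f k b z * (cocycle ?f k d ((?f ^^ b) z) - 1)"
    unfolding d cocycle_add by (simp add: right_diff_distrib)
  also have "norm \<dots> \<le> 1 * (real d * (K * (2 / (1 - r) + 1) / N))"
    unfolding norm_mult
  proof (intro mult_mono)
    show "norm (cocycle ?f k b z) \<le> 1"
      using schur_norm[OF schur_cocycle[OF q k]] z r by simp
    show "norm (cocycle ?f k d ((?f ^^ b) z) - 1) \<le> real d * (K * (2 / (1 - r) + 1) / N)"
      using cocycle_near_power[OF q k _ fz r near, of d] by simp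
  qed auto
  finally show ?thesis by (simp add: d)
qed

lemma cocycle_K_nonneg: "0 \<le> K * (2 / (1 - r) + 1)"
proof -
  have "0 \<le> K / N" using K norm_ge_zero order_trans by blast
  then have "K \<ge> 0" using N by (simp add: zero_le_divide_iff)
  then show ?thesis using r by simp
qed

text \<open>Time t stands for the integer part of N t steps, so for s <= t the number of steps in
  between exceeds N (t - s) by at most one; this is the additional 1/N.\<close>

lemma cocycle_time_diff:
  assumes "0 \<le> s" "0 \<le> t"
  shows "norm (cocycle (\<lambda>z. z * q z) k (nat \<lfloor>real N * t\<rfloor>) z - cocycle (\<lambda>z. z * q z) k (nat \<lfloor>real N * s\<rfloor>) z)
    \<le> K * (2 / (1 - r) + 1) * (\<bar>t - s\<bar> + 1 / N)"
proof -
  have *: "norm (cocycle (\<lambda>z. z * q z) k (nat \<lfloor>real N * t\<rfloor>) z - cocycle (\<lambda>z. z * q z) k (nat \<lfloor>real N * s\<rfloor>) z)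
    \<le> K * (2 / (1 - r) + 1) * ((t - s) + 1 / N)" if "0 \<le> s" "s \<le> t" for s t
  proof -
    have le: "real N * s \<le> real N * t" using that by (intro mult_left_mono) auto
    then have "nat \<lfloor>real N * s\<rfloor> \<le> nat \<lfloor>real N * t\<rfloor>" by (intro nat_mono floor_mono)
    from cocycle_steps_diff[OF this] have
      "norm (cocycle (\<lambda>z. z * q z) k (nat \<lfloor>real N * t\<rfloor>) z - cocycle (\<lambda>z. z * q z) k (nat \<lfloor>real N * s\<rfloor>) z)
        \<le> (real (nat \<lfloor>real N * t\<rfloor>) - real (nat \<lfloor>real N * s\<rfloor>)) * (K * (2 / (1 - r) + 1) / N)" .
    also have "real (nat \<lfloor>real N * t\<rfloor>) - real (nat \<lfloor>real N * s\<rfloor>) \<le> real N * (t - s) + 1"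
    proof -
      have "real (nat \<lfloor>real N * t\<rfloor>) = of_int \<lfloor>real N * t\<rfloor>" "real (nat \<lfloor>real N * s\<rfloor>) = of_int \<lfloor>real N * s\<rfloor>"
        using that by auto
      then show ?thesis unfolding right_diff_distrib by linarith
    qed
    then have "(real (nat \<lfloor>real N * t\<rfloor>) - real (nat \<lfloor>real N * s\<rfloor>)) * (K * (2 / (1 - r) + 1) / N)
        \<le> (real N * (t - s) + 1) * (K * (2 / (1 - r) + 1) / N)"
      using cocycle_K_nonneg by (intro mult_right_mono) auto
    also have "\<dots> = K * (2 / (1 - r) + 1) * (real N * (t - s) + 1) / N" by simp
    also have "\<dots> = K * (2 / (1 - r) + 1) * ((t - s) + 1 / N)"
      using N unfolding times_divide_eq_right[symmetric] add_divide_distrib by simp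
    finally show ?thesis .
  qed
  show ?thesis
  proof (cases "s \<le> t")
    case True
    then show ?thesis using *[OF assms(1) True] by simp
  next
    case False
    then show ?thesis using *[OF assms(2), of s] by (simp add: norm_minus_commute)
  qed
qed

text \<open>Integer parts are additive up to one, so the exact identity for step counts is off by at
  most one step.\<close>

lemma cocycle_time_add:
  assumes "0 \<le> s" "0 \<le> t"
  shows "norm (cocycle (\<lambda>z. z * q z) k (nat \<lfloor>real N * (s + t)\<rfloor>) z -
      cocycle (\<lambda>z. z * q z) k (nat \<lfloor>real N * t\<rfloor>) z *
      cocycle (\<lambda>z. z * q z) k (nat \<lfloor>real N * s\<rfloor>) (z * cocycle (\<lambda>z. z * q z) q (nat \<lfloor>real N * t\<rfloor>) z))
    \<le> K * (2 / (1 - r) + 1) / N"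
proof -
  let ?m = "\<lambda>t. nat \<lfloor>real N * t\<rfloor>"
  have m: "int (?m u) = \<lfloor>real N * u\<rfloor>" if "u \<ge> 0" for u
    using that by simp
  have "\<lfloor>real N * s\<rfloor> + \<lfloor>real N * t\<rfloor> \<le> \<lfloor>real N * (s + t)\<rfloor>"
    "\<lfloor>real N * (s + t)\<rfloor> \<le> \<lfloor>real N * s\<rfloor> + \<lfloor>real N * t\<rfloor> + 1"
    unfolding distrib_left by linarith+
  then have le: "?m s + ?m t \<le> ?m (s + t)" "?m (s + t) \<le> ?m s + ?m t + 1"
    using m[of s] m[of t] m[of "s + t"] assms by linarith+
  have "cocycle (\<lambda>z. z * q z) k (?m s + ?m t) z = cocycle (\<lambda>z. z * q z) k (?m t) z *
      cocycle (\<lambda>z. z * q z) k (?m s) (z * cocycle (\<lambda>z. z * q z) q (?m t) z)"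
    by (simp add: cocycle_add funpow_times)
  then have "norm (cocycle (\<lambda>z. z * q z) k (?m (s + t)) z -
      cocycle (\<lambda>z. z * q z) k (?m t) z *
      cocycle (\<lambda>z. z * q z) k (?m s) (z * cocycle (\<lambda>z. z * q z) q (?m t) z))
      \<le> (real (?m (s + t)) - real (?m s + ?m t)) * (K * (2 / (1 - r) + 1) / N)"
    using cocycle_steps_diff[OF le(1)] by simp
  also have "\<dots> \<le> 1 * (K * (2 / (1 - r) + 1) / N)"
    using le(2) cocycle_K_nonneg by (intro mult_right_mono) auto
  finally show ?thesis by simp
qed

end

text \<open>The three-epsilon half of Arzela--Ascoli. Equicontinuity is asked for only eventually,
  because the functions in question are step functions in time whose jumps shrink with j.\<close>

lemma equicontinuous_convergent_on_closure:
  fixes X :: "nat \<Rightarrow> 'a::metric_space \<Rightarrow> 'b::complete_space"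
  assumes T: "S \<subseteq> closure T" "T \<subseteq> S" "\<And>y. y \<in> T \<Longrightarrow> convergent (\<lambda>j. X j y)"
    and eq: "\<And>x e. x \<in> S \<Longrightarrow> e > 0 \<Longrightarrow>
       \<exists>d>0. \<forall>\<^sub>F j in sequentially. \<forall>y\<in>S. dist y x < d \<longrightarrow> dist (X j x) (X j y) < e"
    and x: "x \<in> S"
  shows "convergent (\<lambda>j. X j x)"
proof -
  have "Cauchy (\<lambda>j. X j x)"
  proof (rule metric_CauchyI)
    fix e :: real assume e: "e > 0"
    obtain d J where d: "d > 0" "\<And>j y. j \<ge> J \<Longrightarrow> y \<in> S \<Longrightarrow> dist y x < d \<Longrightarrow> dist (X j x) (X j y) < e / 3"
      using eq[OF x, of "e / 3"] e by (auto simp: eventually_sequentially)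
    obtain y where y: "y \<in> T" "dist y x < d"
      using x T(1) d(1) closure_approachable by blast
    have "Cauchy (\<lambda>j. X j y)" using T(3)[OF y(1)] by (rule convergent_Cauchy)
    then obtain J' where J': "\<And>i j. i \<ge> J' \<Longrightarrow> j \<ge> J' \<Longrightarrow> dist (X i y) (X j y) < e / 3"
      using metric_CauchyD[of "\<lambda>j. X j y" "e / 3"] e by auto
    have "dist (X i x) (X j x) < e" if "i \<ge> max J J'" "j \<ge> max J J'" for i j
    proof -
      have "dist (X i x) (X i y) < e / 3" "dist (X j x) (X j y) < e / 3" "dist (X i y) (X j y) < e / 3"
        using d(2) J' that y T(2) by auto
      then show ?thesis
        using dist_triangle[of "X i x" "X j x" "X i y"] dist_triangle[of "X i y" "X j x" "X j y"]
        by (simp add: dist_commute)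
    qed
    then show "\<exists>M. \<forall>m\<ge>M. \<forall>n\<ge>M. dist (X m x) (X n x) < e" by blast
  qed
  then show ?thesis by (rule Cauchy_convergent)
qed

lemma cocycle_equicontinuous:
  assumes q: "\<And>j::nat. schur (q j)" and k: "\<And>j. schur (k j)"
    and n: "\<And>j. n j > (0::nat)" "filterlim n at_top sequentially"
    and K: "\<And>j. norm (k j 0 - 1) \<le> K / n j"
    and t: "0 \<le> t" "norm z < 1" "e > 0"
  shows "\<exists>d>0. \<forall>\<^sub>F j in sequentially. \<forall>s w. 0 \<le> s \<longrightarrow> norm w < 1 \<longrightarrow> dist (s, w) (t, z) < d \<longrightarrow>
     dist (cocycle (\<lambda>z. z * q j z) (k j) (nat \<lfloor>real (n j) * t\<rfloor>) z)
          (cocycle (\<lambda>z. z * q j z) (k j) (nat \<lfloor>real (n j) * s\<rfloor>) w) < e"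
proof -
  define r where "r = (1 + norm z) / 2"
  define C where "C = K * (2 / (1 - r) + 1)"
  define L where "L = 2 / (1 - r)"
  have r: "norm z \<le> r" "r < 1" using t by (auto simp: r_def)
  have C: "C \<ge> 0"
    unfolding C_def by (rule cocycle_K_nonneg[OF q k n(1) K r])
  have L: "L \<ge> 0" using r by (simp add: L_def)
  \<comment> \<open>The first bound keeps w in the disc of radius r, halfway between
    \<open>norm z\<close> and 1; the second leaves e/2 for the jump term C / n j.\<close>
  define d where "d = min ((1 - norm z) / 2) (e / (2 * (C + L + 1)))"
  have d: "d > 0" using t C L by (simp add: d_def)
  have dCL: "d * (C + L) \<le> e / 2"
  proof -
    have "d * (C + L) \<le> d * (C + L + 1)" using d by (intro mult_left_mono) auto
    also have "\<dots> \<le> e / (2 * (C + L + 1)) * (C + L + 1)" using C L by (intro mult_right_mono) (auto simp: d_def)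
    also have "\<dots> = e / 2" using C L by (simp add: field_simps)
    finally show ?thesis .
  qed
  have "filterlim (\<lambda>j. real (n j)) at_top sequentially"
    using filterlim_compose[OF filterlim_real_sequentially n(2)] .
  then have "(\<lambda>j. C / real (n j)) \<longlonglongrightarrow> 0"
    by (intro tendsto_divide_0[OF tendsto_const] filterlim_at_top_imp_at_infinity)
  then have "\<forall>\<^sub>F j in sequentially. C / real (n j) < e / 2"
    using t(3) by (intro order_tendstoD(2)) auto
  then have "\<forall>\<^sub>F j in sequentially. \<forall>s w. 0 \<le> s \<longrightarrow> norm w < 1 \<longrightarrow> dist (s, w) (t, z) < d \<longrightarrow>
     dist (cocycle (\<lambda>z. z * q j z) (k j) (nat \<lfloor>real (n j) * t\<rfloor>) z)
          (cocycle (\<lambda>z. z * q j z) (k j) (nat \<lfloor>real (n j) * s\<rfloor>) w) < e"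
  proof eventually_elim
    case (elim j)
    show ?case
    proof (intro allI impI)
      fix s :: real and w :: complex
      assume s: "0 \<le> s" "norm w < 1" "dist (s, w) (t, z) < d"
      have sd: "\<bar>t - s\<bar> \<le> d" "norm (z - w) \<le> d"
        using s(3) dist_fst_le[of "(s,w)" "(t,z)"] dist_snd_le[of "(s,w)" "(t,z)"]
        by (auto simp: dist_norm norm_minus_commute abs_minus_commute)
      have "norm w \<le> norm z + norm (z - w)" by (metis norm_minus_commute norm_triangle_sub)
      also have "\<dots> \<le> r" using sd(2) by (simp add: d_def r_def field_simps)
      finally have w: "norm w \<le> r" .
      let ?U = "\<lambda>t. cocycle (\<lambda>z. z * q j z) (k j) (nat \<lfloor>real (n j) * t\<rfloor>)"
      have "norm (?U t z - ?U s z) \<le> C * (\<bar>t - s\<bar> + 1 / n j)"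
        unfolding C_def by (rule cocycle_time_diff[OF q k n(1) K r s(1) t(1)])
      moreover have "norm (?U s z - ?U s w) \<le> L * norm (z - w)"
        unfolding L_def by (rule schur_Lipschitz[OF schur_cocycle[OF q k] r(1) w r(2)])
      ultimately have "norm (?U t z - ?U s w) \<le> C * (\<bar>t - s\<bar> + 1 / n j) + L * norm (z - w)"
        by (rule norm_diff_triangle_le)
      also have "\<dots> \<le> C * (d + 1 / n j) + L * d"
        using sd C L by (intro add_mono mult_left_mono) auto
      also have "\<dots> = d * (C + L) + C / n j" by (simp add: algebra_simps)
      also have "\<dots> < e" using dCL elim by linarith
      finally show "dist (?U t z) (?U s w) < e" by (simp add: dist_norm)
    qed
  qed
  then show ?thesis using d by blast
qed

lemma limit_schur_semigroup:
  assumes q: "\<And>j::nat. schur (q j)" and g: "\<And>j. schur (g j)"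
    and n: "\<And>j. n j > (0::nat)" "filterlim n at_top sequentially"
    and Kq: "\<And>j. norm (q j 0 - 1) \<le> K / n j" and Kg: "\<And>j. norm (g j 0 - 1) \<le> K / n j"
    and P: "\<And>t z. 0 \<le> t \<Longrightarrow> norm z < 1 \<Longrightarrow>
      (\<lambda>j. cocycle (\<lambda>z. z * q j z) (q j) (nat \<lfloor>real (n j) * t\<rfloor>) z) \<longlonglongrightarrow> P t z"
    and H: "\<And>t z. 0 \<le> t \<Longrightarrow> norm z < 1 \<Longrightarrow>
      (\<lambda>j. cocycle (\<lambda>z. z * q j z) (g j) (nat \<lfloor>real (n j) * t\<rfloor>) z) \<longlonglongrightarrow> H t z"
  shows "schur_semigroup P H"
proof -
  have n0: "(\<lambda>j. c / real (n j)) \<longlonglongrightarrow> 0" for c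
    using filterlim_compose[OF filterlim_real_sequentially n(2)]
    by (intro tendsto_divide_0[OF tendsto_const] filterlim_at_top_imp_at_infinity)
  have schurP: "schur (P t)" if "t \<ge> 0" for t
    using schur_cocycle[OF q q] P[OF that] by (rule schur_pointwise_limit)
  \<comment> \<open>Proved for a generic component \<open>k\<close> with limit \<open>V\<close>; the
    instances are q with P and g with H.\<close>
  have lim: "schur (V t)" "norm z < 1 \<Longrightarrow> V 0 z = 1"
    "norm z < 1 \<Longrightarrow> V (s + t) z = V t z * V s (z * P t z)"
    "norm z < 1 \<Longrightarrow> continuous_on {0..} (\<lambda>t. V t z)"
    if k: "\<And>j. schur (k j)" and K: "\<And>j. norm (k j 0 - 1) \<le> K / n j" and st: "0 \<le> s" "0 \<le> t"
      and V: "\<And>t z. 0 \<le> t \<Longrightarrow> norm z < 1 \<Longrightarrow>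
      (\<lambda>j. cocycle (\<lambda>z. z * q j z) (k j) (nat \<lfloor>real (n j) * t\<rfloor>) z) \<longlonglongrightarrow> V t z"
    for k V s t z
  proof -
    let ?U = "\<lambda>j t. cocycle (\<lambda>z. z * q j z) (k j) (nat \<lfloor>real (n j) * t\<rfloor>)"
    let ?Q = "\<lambda>j t. cocycle (\<lambda>z. z * q j z) (q j) (nat \<lfloor>real (n j) * t\<rfloor>)"
    show "schur (V t)"
      using schur_cocycle[OF q k] V[OF st(2)] by (rule schur_pointwise_limit)
    show "V 0 z = 1" if "norm z < 1"
      using V[OF order_refl that] by (simp add: LIMSEQ_const_iff)
    show "V (s + t) z = V t z * V s (z * P t z)" if z: "norm z < 1"
    proof -
      define r where "r = norm z"
      have r: "norm z \<le> r" "r < 1" using z by (auto simp: r_def)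
      have zP: "norm (z * P t z) \<le> r" "norm (z * P t z) < 1"
        using schur_norm_less[OF schurP[OF st(2)] z] by (auto simp: r_def)
      have zQ: "norm (z * ?Q j t z) \<le> r" for j
        using schur_norm_less(1)[OF schur_cocycle[OF q q] z] by (auto simp: r_def)
      \<comment> \<open>The inner argument varies with j as well; a Lipschitz bound uniform in j
        replaces it by its limit.\<close>
      have "(\<lambda>j. ?U j s (z * ?Q j t z) - ?U j s (z * P t z)) \<longlonglongrightarrow> 0"
      proof (rule Lim_null_comparison)
        show "\<forall>\<^sub>F j in sequentially. norm (?U j s (z * ?Q j t z) - ?U j s (z * P t z)) \<le>
           2 / (1 - r) * norm (z * ?Q j t z - z * P t z)"
          using schur_Lipschitz[OF schur_cocycle[OF q k] zQ zP(1) r(2)] by (intro always_eventually) blast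
        have "(\<lambda>j. 2 / (1 - r) * norm (z * ?Q j t z - z * P t z)) \<longlonglongrightarrow> 2 / (1 - r) * norm (z * P t z - z * P t z)"
          by (intro tendsto_intros P st z)
        then show "(\<lambda>j. 2 / (1 - r) * norm (z * ?Q j t z - z * P t z)) \<longlonglongrightarrow> 0" by simp
      qed
      from tendsto_add[OF this V[OF st(1) zP(2)]]
      have 1: "(\<lambda>j. ?U j t z * ?U j s (z * ?Q j t z)) \<longlonglongrightarrow> V t z * V s (z * P t z)"
        using V[OF st(2) z] by (intro tendsto_mult) auto
      have "(\<lambda>j. ?U j (s + t) z - ?U j t z * ?U j s (z * ?Q j t z)) \<longlonglongrightarrow> 0"
      proof (rule Lim_null_comparison)
        show "\<forall>\<^sub>F j in sequentially. norm (?U j (s + t) z - ?U j t z * ?U j s (z * ?Q j t z)) \<le>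
           K * (2 / (1 - r) + 1) / n j"
          using cocycle_time_add[OF q k n(1) K r st] by (intro always_eventually) blast
      qed (rule n0)
      from tendsto_add[OF this 1] have "(\<lambda>j. ?U j (s + t) z) \<longlonglongrightarrow> V t z * V s (z * P t z)" by simp
      then show ?thesis using LIMSEQ_unique[OF V[of "s + t" z]] st z by simp
    qed
    show "continuous_on {0..} (\<lambda>t. V t z)" if z: "norm z < 1"
    proof -
      define C where "C = K * (2 / (1 - norm z) + 1)"
      have lip: "norm (V t z - V s z) \<le> C * \<bar>t - s\<bar>" if st: "0 \<le> s" "0 \<le> t" for s t
      proof (rule tendsto_le[OF sequentially_bot])
        show "(\<lambda>j. norm (?U j t z - ?U j s z)) \<longlonglongrightarrow> norm (V t z - V s z)"
          by (intro tendsto_intros V st z)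
        have "(\<lambda>j. C * \<bar>t - s\<bar> + C / n j) \<longlonglongrightarrow> C * \<bar>t - s\<bar> + 0"
          by (intro tendsto_intros n0)
        then show "(\<lambda>j. C * (\<bar>t - s\<bar> + 1 / n j)) \<longlonglongrightarrow> C * \<bar>t - s\<bar>" by (simp add: distrib_left)
        show "\<forall>\<^sub>F j in sequentially. norm (?U j t z - ?U j s z) \<le> C * (\<bar>t - s\<bar> + 1 / n j)"
          unfolding C_def using cocycle_time_diff[OF q k n(1) K order_refl z st] by (intro always_eventually) blast
      qed
      have "C \<ge> 0" unfolding C_def by (rule cocycle_K_nonneg[OF q k n(1) K order_refl z])
      then have "C-lipschitz_on {0..} (\<lambda>t. V t z)"
        using lip by (intro lipschitz_onI) (auto simp: dist_norm)
      then show ?thesis by (rule lipschitz_on_continuous_on)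
    qed
  qed
  show ?thesis
    unfolding schur_semigroup_def
    using lim[OF q Kq _ _ P] lim[OF g Kg _ _ H] lim(2,4)[OF q Kq order_refl order_refl P]
      lim(2,4)[OF g Kg order_refl order_refl H] by auto
qed

lemma semigroup_of_slow_roots:
  assumes roots: "\<And>j::nat. is_root p h (n j) (q j) (g j)"
    and n: "\<And>j. n j > (0::nat)" "filterlim n at_top sequentially"
    and Kq: "\<And>j. norm (q j 0 - 1) \<le> K / n j" and Kg: "\<And>j. norm (g j 0 - 1) \<le> K / n j"
  obtains P H where "schur_semigroup P H" "\<And>z. norm z < 1 \<Longrightarrow> P 1 z = p z" "\<And>z. norm z < 1 \<Longrightarrow> H 1 z = h z"
proof -
  have q: "schur (q j)" and g: "schur (g j)" for j using roots by (auto simp: is_root_def)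
  define UP where "UP j x = cocycle (\<lambda>z. z * q j z) (q j) (nat \<lfloor>real (n j) * fst x\<rfloor>) (snd x)" for j x
  define UH where "UH j x = cocycle (\<lambda>z. z * q j z) (g j) (nat \<lfloor>real (n j) * fst x\<rfloor>) (snd x)" for j x
  define S where "S = {0::real..} \<times> ball (0::complex) 1"
  \<comment> \<open>A diagonal subsequence converges on countably many pairs of a time and a point;
    equicontinuity then extends this to all of \<open>S\<close>.\<close>
  obtain T where T: "countable T" "T \<subseteq> S" "S \<subseteq> closure T" by (rule separable)
  have bd: "norm (UP j x) \<le> 1" "norm (UH j x) \<le> 1" if "x \<in> T" for j x
    using that T(2) schur_norm[OF schur_cocycle[OF q q]] schur_norm[OF schur_cocycle[OF q g]]
    by (auto simp: UP_def UH_def S_def)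
  have "norm (UP j x, UH j x) \<le> 2" if "x \<in> T" for j x
    using norm_Pair_le[of "UP j x" "UH j x"] bd[OF that, of j] by linarith
  then obtain \<sigma> where \<sigma>: "strict_mono (\<sigma>::nat \<Rightarrow> nat)" "\<And>x. x \<in> T \<Longrightarrow> \<exists>l. (\<lambda>j. (UP (\<sigma> j) x, UH (\<sigma> j) x)) \<longlonglongrightarrow> l"
    using function_convergent_subsequence[OF T(1), of "\<lambda>j x. (UP j x, UH j x)" 2] by blast
  have convT: "convergent (\<lambda>j. UP (\<sigma> j) x)" "convergent (\<lambda>j. UH (\<sigma> j) x)" if x: "x \<in> T" for x
  proof -
    obtain l where "(\<lambda>j. (UP (\<sigma> j) x, UH (\<sigma> j) x)) \<longlonglongrightarrow> l" using \<sigma>(2)[OF x] by blast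
    from tendsto_fst[OF this] tendsto_snd[OF this]
    show "convergent (\<lambda>j. UP (\<sigma> j) x)" "convergent (\<lambda>j. UH (\<sigma> j) x)" by (auto simp: convergent_def)
  qed
  have n': "filterlim (\<lambda>j. n (\<sigma> j)) at_top sequentially"
    using filterlim_compose[OF n(2) filterlim_subseq[OF \<sigma>(1)]] .
  have conv: "convergent (\<lambda>j. UP (\<sigma> j) x)" "convergent (\<lambda>j. UH (\<sigma> j) x)" if x: "x \<in> S" for x
  proof -
    have eqc: "\<exists>d>0. \<forall>\<^sub>F j in sequentially. \<forall>y\<in>S. dist y x < d \<longrightarrow>
      dist (cocycle (\<lambda>z. z * q (\<sigma> j) z) (k (\<sigma> j)) (nat \<lfloor>real (n (\<sigma> j)) * fst x\<rfloor>) (snd x))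
        (cocycle (\<lambda>z. z * q (\<sigma> j) z) (k (\<sigma> j)) (nat \<lfloor>real (n (\<sigma> j)) * fst y\<rfloor>) (snd y)) < e"
      if k: "\<And>j. schur (k j)" "\<And>j. norm (k j 0 - 1) \<le> K / n j" and xe: "x \<in> S" "e > 0" for k x e
    proof -
      have x: "0 \<le> fst x" "norm (snd x) < 1" using xe by (auto simp: S_def)
      obtain d where d: "d > 0" "\<forall>\<^sub>F j in sequentially. \<forall>s w. 0 \<le> s \<longrightarrow> norm w < 1 \<longrightarrow> dist (s, w) x < d \<longrightarrow>
          dist (cocycle (\<lambda>z. z * q (\<sigma> j) z) (k (\<sigma> j)) (nat \<lfloor>real (n (\<sigma> j)) * fst x\<rfloor>) (snd x))
            (cocycle (\<lambda>z. z * q (\<sigma> j) z) (k (\<sigma> j)) (nat \<lfloor>real (n (\<sigma> j)) * s\<rfloor>) w) < e"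
        using cocycle_equicontinuous[of "\<lambda>j. q (\<sigma> j)" "\<lambda>j. k (\<sigma> j)" "\<lambda>j. n (\<sigma> j)", OF q k(1) n(1) n' k(2) x xe(2)]
        by auto
      show ?thesis
        by (rule exI[of _ d], intro conjI d(1) eventually_mono[OF d(2)]) (auto simp: S_def)
    qed
    show "convergent (\<lambda>j. UP (\<sigma> j) x)"
      by (rule equicontinuous_convergent_on_closure[OF T(3,2) convT(1) _ x])
        (auto simp: UP_def intro: eqc[OF q Kq])
    show "convergent (\<lambda>j. UH (\<sigma> j) x)"
      by (rule equicontinuous_convergent_on_closure[OF T(3,2) convT(2) _ x])
        (auto simp: UH_def intro: eqc[OF g Kg])
  qed
  define P where "P t z = lim (\<lambda>j. UP (\<sigma> j) (t, z))" for t z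
  define H where "H t z = lim (\<lambda>j. UH (\<sigma> j) (t, z))" for t z
  have limP: "(\<lambda>j. UP (\<sigma> j) (t, z)) \<longlonglongrightarrow> P t z" and limH: "(\<lambda>j. UH (\<sigma> j) (t, z)) \<longlonglongrightarrow> H t z"
    if "0 \<le> t" "norm z < 1" for t z
    using conv[of "(t, z)"] that by (auto simp: S_def P_def H_def convergent_LIMSEQ_iff)
  have "schur_semigroup P H"
    using limP limH unfolding UP_def UH_def fst_conv snd_conv
    by (rule limit_schur_semigroup[OF q g n(1) n' Kq Kg])
  \<comment> \<open>At time 1 the step count is exactly the order of the root, so both sequences are
    constant.\<close>
  moreover have "UP (\<sigma> j) (1, z) = p z" "UH (\<sigma> j) (1, z) = h z" if "norm z < 1" for j z
    using roots[of "\<sigma> j"] that by (auto simp: UP_def UH_def is_root_def)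
  then have "P 1 z = p z" "H 1 z = h z" if "norm z < 1" for z
    using limP[of 1 z] limH[of 1 z] that by (auto simp: LIMSEQ_const_iff)
  ultimately show ?thesis using that by blast
qed

section \<open>Explicit and rotated semigroups, and the embedding of a pair with roots\<close>

lemma cocycle_scale: "cocycle f (\<lambda>z. c * g z) m z = c ^ m * cocycle f g m z"
  by (simp add: cocycle_def prod.distrib)

lemma schur_semigroup_const:
  assumes "norm a \<le> 1" "norm b \<le> 1" "a \<noteq> 0" "b \<noteq> 0"
  shows "schur_semigroup (\<lambda>t _. exp (of_real t * Ln a)) (\<lambda>t _. exp (of_real t * Ln b))"
proof -
  have "schur (\<lambda>_. exp (of_real t * Ln x))" if "norm x \<le> 1" "x \<noteq> 0" "t \<ge> 0" for t x
    using that by (intro schur_const) (simp add: mult_nonneg_nonpos)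
  then show ?thesis
    unfolding schur_semigroup_def using assms
    by (auto simp: distrib_right exp_add intro!: continuous_intros)
qed

text \<open>A character of time does not disturb the cocycle identity. This restores the argument of
  \<open>h 0\<close>, which is divided out before passing to the limit.\<close>

lemma schur_semigroup_rotate:
  assumes "schur_semigroup P H"
  shows "schur_semigroup P (\<lambda>t z. cis (t * \<theta>) * H t z)"
proof -
  have "schur (\<lambda>z. cis (t * \<theta>) * H t z)" if "t \<ge> 0" for t
    using assms that by (intro schur_mult schur_const) (auto simp: schur_semigroup_def)
  moreover have "cis ((s + t) * \<theta>) = cis (t * \<theta>) * cis (s * \<theta>)" for s t
    by (simp add: cis_mult algebra_simps)
  ultimately show ?thesis
    using assms unfolding schur_semigroup_def by (auto intro!: continuous_intros)
qed

theorem schur_semigroup_embedding: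
  assumes p: "schur p" and h: "schur h"
    and roots: "\<And>n. 2 \<le> n \<Longrightarrow> \<exists>q g. is_root p h n q g"
    and nz: "norm z1 < 1" "p z1 \<noteq> 0" "norm z2 < 1" "h z2 \<noteq> 0"
  obtains P H where "schur_semigroup P H" "\<And>z. norm z < 1 \<Longrightarrow> P 1 z = p z" "\<And>z. norm z < 1 \<Longrightarrow> H 1 z = h z"
proof -
  have p0: "p 0 \<noteq> 0"
    by (rule nonzero_at_0_of_roots[of p, OF _ nz(1,2)]) (use roots in \<open>unfold is_root_def, blast\<close>)
  have h0: "h 0 \<noteq> 0"
    by (rule nonzero_at_0_of_roots[of h, OF _ nz(3,4)]) (use roots in \<open>unfold is_root_def, blast\<close>)
  have le: "norm (p 0) \<le> 1" "norm (h 0) \<le> 1" using schur_norm[OF p, of 0] schur_norm[OF h, of 0] by auto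
  define fast where "fast \<epsilon> \<longleftrightarrow> (\<exists>n q g \<alpha>. is_root p h n q g \<and> q 0 = of_real (norm (q 0)) * cis \<alpha> \<and>
          \<bar>\<alpha>\<bar> \<le> \<epsilon> \<and> 1 \<le> \<epsilon> * (real n * \<bar>\<alpha>\<bar>))" for \<epsilon>
  show ?thesis
  proof (cases "\<forall>\<epsilon>>0. fast \<epsilon>")
    case True
    then have ex: "fast \<epsilon>" if "\<epsilon> > 0" for \<epsilon> using that by blast
    have const: "p z = p 0" "h z = h 0" if "norm z < 1" for z
      using constant_of_fast_rotating_roots[OF p p0 h h0 ex[unfolded fast_def] that] by simp_all
    show ?thesis
    proof (rule that[OF schur_semigroup_const[OF le p0 h0]])
      fix z :: complex assume z: "norm z < 1"
      show "exp (of_real 1 * Ln (p 0)) = p z" by (subst const(1)[OF z]) (use p0 in simp)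
      show "exp (of_real 1 * Ln (h 0)) = h z" by (subst const(2)[OF z]) (use h0 in simp)
    qed
  next
    case False
    then obtain \<epsilon> where \<epsilon>: "\<epsilon> > 0" and nfast: "\<not> fast \<epsilon>" by blast
    have slow: "\<epsilon> * (real n * \<bar>\<alpha>\<bar>) < 1"
      if "is_root p h n q g" "q 0 = of_real (norm (q 0)) * cis \<alpha>" "\<bar>\<alpha>\<bar> \<le> \<epsilon>" for n q g \<alpha>
    proof (rule ccontr)
      assume "\<not> \<epsilon> * (real n * \<bar>\<alpha>\<bar>) < 1"
      then have "fast \<epsilon>" unfolding fast_def
        by (intro exI[of _ n] exI[of _ q] exI[of _ g] exI[of _ \<alpha>] conjI that) simp
      with nfast show False ..
    qed
    \<comment> \<open>The losses of modulus of the two components, plus 1 / \<epsilon>, which bounds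
      n |\<alpha>| because fast rotation fails at \<epsilon>.\<close>
    define K where "K = - ln (norm (p 0)) - ln (norm (h 0)) + 1 / \<epsilon>"
    \<comment> \<open>Rotates h so that its value at 0 becomes positive. Each root is rotated
      accordingly by a constant \<open>d\<close> with d ^ n = c, which makes its value at 0 positive
      too.\<close>
    define c where "c = cnj (sgn (h 0))"
    have ex: "\<exists>n q g. j < n \<and> is_root p (\<lambda>z. c * h z) n q g \<and> norm (q 0 - 1) \<le> K / n \<and> norm (g 0 - 1) \<le> K / n"
      for j :: nat
    proof -
      \<comment> \<open>Large enough for the argument bound 2 pi / (j + i + 2) to be at most
        \<epsilon>, so that \<open>slow\<close> applies.\<close>
      obtain i :: nat where i: "2 * pi / \<epsilon> < real i" using reals_Archimedean2 by blast
      obtain n q g \<alpha> where r: "j + i + 2 \<le> n" "is_root p h n q g" "q 0 = of_real (norm (q 0)) * cis \<alpha>"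
        "\<bar>\<alpha>\<bar> \<le> 2 * pi / real (j + i + 2)"
        using is_root_small_argument[OF roots, of "j + i + 2"] by (metis le_add2)
      have n: "n > 0" using r(1) by simp
      have "2 * pi / \<epsilon> \<le> real (j + i + 2)" using i by linarith
      then have "2 * pi / real (j + i + 2) \<le> \<epsilon>" using \<epsilon> by (simp add: field_simps)
      then have "\<epsilon> * (real n * \<bar>\<alpha>\<bar>) < 1" using slow[OF r(2,3)] r(4) by linarith
      then have \<alpha>: "\<bar>\<alpha>\<bar> \<le> 1 / \<epsilon> / n" using \<epsilon> n by (simp add: field_simps)
      have g: "schur g" and q: "schur q" using r(2) by (auto simp: is_root_def)
      have lnle: "0 \<le> - ln (norm (p 0))" "0 \<le> - ln (norm (h 0))" using le p0 h0 by auto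
      have "1 / \<epsilon> > 0" using \<epsilon> by simp
      then have K_ge: "- ln (norm (p 0)) + 1 / \<epsilon> \<le> K" "- ln (norm (h 0)) \<le> K"
        unfolding K_def using lnle by linarith+
      have "norm (q 0 - 1) \<le> norm (q 0 - cis \<alpha>) + norm (cis \<alpha> - 1)"
        using norm_triangle_ineq[of "q 0 - cis \<alpha>" "cis \<alpha> - 1"] by simp
      also have "norm (cis \<alpha> - 1) \<le> 1 / \<epsilon> / n"
        using norm_cis_diff_le[of \<alpha> 0] \<alpha> by simp
      also have "q 0 - cis \<alpha> = of_real (norm (q 0) - 1) * cis \<alpha>"
        by (subst r(3)) (simp add: algebra_simps)
      also have "norm \<dots> = \<bar>norm (q 0) - 1\<bar>"
        by (simp only: norm_mult norm_of_real norm_cis mult_1_right)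
      also have "\<dots> = 1 - norm (q 0)"
        using schur_norm[OF q, of 0] by simp
      also have "\<dots> \<le> - ln (norm (p 0)) / n"
        by (rule one_minus_norm_root_le[OF is_root_at_0(1)[OF r(2)] p0 n])
      finally have "norm (q 0 - 1) \<le> (- ln (norm (p 0)) + 1 / \<epsilon>) / n" by (simp add: add_divide_distrib diff_divide_distrib)
      also have "\<dots> \<le> K / n" using K_ge(1) by (rule divide_right_mono) simp
      finally have Kq: "norm (q 0 - 1) \<le> K / n" .
      define d where "d = cnj (sgn (g 0))"
      have g0: "g 0 \<noteq> 0" using is_root_at_0(2)[OF r(2)] h0 n by (metis zero_power)
      have d1: "norm d = 1" using g0 by (simp add: d_def norm_sgn)
      have sgn_pow: "sgn (x ^ m) = sgn x ^ m" for x :: complex and m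
        by (induction m) (auto simp: sgn_mult)
      have dn: "d ^ n = c"
        by (simp add: d_def c_def sgn_pow flip: is_root_at_0(2)[OF r(2)])
      have dg: "d * g 0 = of_real (norm (g 0))"
      proof -
        have "cnj (g 0) * g 0 = of_real (norm (g 0)) * of_real (norm (g 0))"
          using complex_norm_square[of "g 0"] by (simp add: power2_eq_square mult.commute)
        then show ?thesis using g0 by (simp add: d_def sgn_eq)
      qed
      have "is_root p (\<lambda>z. c * h z) n q (\<lambda>z. d * g z)"
        using r(2) d1 by (auto simp: is_root_def cocycle_scale dn intro!: schur_mult schur_const)
      moreover have "norm (d * g 0 - 1) \<le> K / n"
      proof -
        have "norm (d * g 0 - 1) = norm (of_real (norm (g 0) - 1) :: complex)" by (simp add: dg)
        also have "\<dots> = 1 - norm (g 0)" using schur_norm[OF g, of 0] by (subst norm_of_real) simp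
        also have "\<dots> \<le> - ln (norm (h 0)) / n"
          by (rule one_minus_norm_root_le[OF is_root_at_0(2)[OF r(2)] h0 n])
        also have "\<dots> \<le> K / n" using K_ge(2) by (rule divide_right_mono) simp
        finally show ?thesis .
      qed
      ultimately show ?thesis using r(1) Kq by (intro exI[of _ n] exI[of _ q] exI[of _ "\<lambda>z. d * g z"]) auto
    qed
    then obtain n q g where nqg: "\<And>j::nat. j < n j" "\<And>j. is_root p (\<lambda>z. c * h z) (n j) (q j) (g j)"
      "\<And>j. norm (q j 0 - 1) \<le> K / n j" "\<And>j. norm (g j 0 - 1) \<le> K / n j"
      by metis
    have n_pos: "n j > 0" for j using nqg(1)[of j] by simp
    have n_lim: "filterlim n at_top sequentially"
      by (intro filterlim_at_top_mono[OF filterlim_ident] always_eventually allI less_imp_le nqg(1))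
    obtain P H where PH: "schur_semigroup P H" "\<And>z. norm z < 1 \<Longrightarrow> P 1 z = p z"
        "\<And>z. norm z < 1 \<Longrightarrow> H 1 z = c * h z"
      by (rule semigroup_of_slow_roots[of p "\<lambda>z. c * h z" n q g K, OF nqg(2) n_pos n_lim nqg(3,4)]) blast
    have "cis (Arg (h 0)) * (c * h z) = h z" for z
    proof -
      have "cis (Arg (h 0)) * c = 1"
        using h0 by (simp add: c_def cis_Arg complex_norm_square[symmetric] norm_sgn)
      then show ?thesis by (simp flip: mult.assoc)
    qed
    then show ?thesis
      using that[OF schur_semigroup_rotate[OF PH(1), of "Arg (h 0)"]] PH(2,3) by simp
  qed
qed

section \<open>Moments and the eta transform\<close>

lemma probT_AE:
  assumes "probT M"
  shows "AE x in M. norm x = 1"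
proof -
  interpret prob_space M using assms by (simp add: probT_def)
  have "prob (sphere 0 1) = 1" using assms by (simp add: probT_def measure_def)
  from AE_prob_1[OF this] show ?thesis by simp
qed

lemma probT_prob_space: "probT M \<Longrightarrow> prob_space M"
  and probT_sets: "probT M \<Longrightarrow> sets M = sets borel"
  by (auto simp: probT_def)

lemma probT_integrable:
  fixes f :: "complex \<Rightarrow> 'a::{banach, second_countable_topology}"
  assumes M: "probT M" and f: "f \<in> borel_measurable borel" and B: "\<And>x. norm x = 1 \<Longrightarrow> norm (f x) \<le> B"
  shows "integrable M f"
proof -
  interpret prob_space M using M by (rule probT_prob_space)
  show ?thesis
  proof (rule integrable_const_bound)
    show "AE x in M. norm (f x) \<le> B" using probT_AE[OF M] by eventually_elim (rule B)
    show "f \<in> borel_measurable M" using f probT_sets[OF M] measurable_cong_sets by blast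
  qed
qed

lemma probT_integral_norm_le:
  fixes f :: "complex \<Rightarrow> 'a::{banach, second_countable_topology}"
  assumes M: "probT M" and f: "f \<in> borel_measurable borel" and B: "\<And>x. norm x = 1 \<Longrightarrow> norm (f x) \<le> B"
  shows "norm (integral\<^sup>L M f) \<le> B"
proof -
  interpret prob_space M using M by (rule probT_prob_space)
  have "norm (integral\<^sup>L M f) \<le> (\<integral>x. norm (f x) \<partial>M)" by (rule integral_norm_bound)
  also have "\<dots> \<le> B"
  proof (rule integral_le_const)
    show "integrable M (\<lambda>x. norm (f x))" using probT_integrable[OF assms] by simp
    show "AE x in M. norm (f x) \<le> B" using probT_AE[OF M] by eventually_elim (rule B)
  qed
  finally show ?thesis .
qed

definition mom :: "complex measure \<Rightarrow> nat \<Rightarrow> complex" where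
  "mom M k = (\<integral>x. x ^ k \<partial>M)"

lemma mom_norm_le: "probT M \<Longrightarrow> norm (mom M k) \<le> 1"
  unfolding mom_def by (rule probT_integral_norm_le) (auto simp: norm_power)

text \<open>The geometric series integrated term by term; on the circle its terms are dominated by
  powers of \<open>norm z\<close>.\<close>

lemma psiT_sums:
  assumes M: "probT M" and z: "norm z < 1"
  shows "(\<lambda>k. mom M (Suc k) * z ^ Suc k) sums psiT M z"
proof -
  interpret prob_space M using M by (rule probT_prob_space)
  have [measurable]: "(\<lambda>x. x) \<in> borel_measurable M"
    using probT_sets[OF M] by (rule measurable_ident_sets)
  have int: "integrable M (\<lambda>x. (z * x) ^ Suc k)" for k
    by (rule probT_integrable[OF M, of _ "norm z ^ Suc k"]) (auto simp: norm_power norm_mult)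
  have nint: "(\<integral>x. norm ((z * x) ^ Suc k) \<partial>M) = norm z ^ Suc k" for k
  proof -
    have "(\<integral>x. norm ((z * x) ^ Suc k) \<partial>M) = (\<integral>x. norm z ^ Suc k \<partial>M)"
    proof (rule integral_cong_AE)
      show "AE x in M. norm ((z * x) ^ Suc k) = norm z ^ Suc k"
        using probT_AE[OF M] by eventually_elim (simp add: norm_power norm_mult)
    qed (use int in auto)
    then show ?thesis by (simp add: prob_space)
  qed
  have s: "summable (\<lambda>k. norm z ^ Suc k)"
    using z by (simp add: summable_geometric summable_mult)
  have "(\<lambda>k. \<integral>x. (z * x) ^ Suc k \<partial>M) sums (\<integral>x. (\<Sum>k. (z * x) ^ Suc k) \<partial>M)"
  proof (rule sums_integral[OF int])
    show "AE x in M. summable (\<lambda>i. norm ((z * x) ^ Suc i))"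
      using probT_AE[OF M]
    proof eventually_elim
      case (elim x)
      then have "norm ((z * x) ^ Suc i) = norm z ^ Suc i" for i by (simp add: norm_power norm_mult)
      then show ?case using s by simp
    qed
    show "summable (\<lambda>i. \<integral>x. norm ((z * x) ^ Suc i) \<partial>M)" unfolding nint by (rule s)
  qed
  also have "(\<integral>x. (\<Sum>k. (z * x) ^ Suc k) \<partial>M) = psiT M z"
    unfolding psiT_def
  proof (rule integral_cong_AE)
    show "AE x in M. (\<Sum>k. (z * x) ^ Suc k) = z * x / (1 - z * x)"
      using probT_AE[OF M]
    proof eventually_elim
      case (elim x)
      then have "norm (z * x) < 1" using z by (simp add: norm_mult)
      from sums_mult[OF geometric_sums[OF this], of "z * x"]
      show ?case by (simp add: sums_iff)
    qed
  qed measurable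
  also have "(\<lambda>k. \<integral>x. (z * x) ^ Suc k \<partial>M) = (\<lambda>k. mom M (Suc k) * z ^ Suc k)"
    unfolding mom_def power_mult_distrib by (intro ext) (simp del: power_Suc add: mult.commute)
  finally show ?thesis .
qed

text \<open>\<open>mom M 0\<close> is 1 for a probability measure, but psi has no constant
  term.\<close>

definition psi_coeff :: "complex measure \<Rightarrow> nat \<Rightarrow> complex" where
  "psi_coeff M n = (if n = 0 then 0 else mom M n)"

lemma psiT_power_series:
  assumes "probT M" "norm z < 1"
  shows "(\<lambda>n. psi_coeff M n * z ^ n) sums psiT M z"
  using psiT_sums[OF assms] sums_Suc_iff[of "\<lambda>n. psi_coeff M n * z ^ n"] by (simp add: psi_coeff_def)

lemma psiT_holo: "probT M \<Longrightarrow> psiT M holomorphic_on ball 0 1"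
  using psiT_power_series by (intro power_series_holomorphic[where a = "psi_coeff M"]) simp

lemma psiT_0 [simp]: "psiT M 0 = 0"
  by (simp add: psiT_def)

lemma psiT_deriv_0:
  assumes M: "probT M"
  shows "(psiT M has_field_derivative mom M 1) (at 0)"
proof -
  have "((\<lambda>z. \<Sum>n. psi_coeff M n * z ^ n) has_field_derivative (\<Sum>n. diffs (psi_coeff M) n * 0 ^ n)) (at 0)"
    using psiT_power_series[OF M]
    by (intro termdiffs_strong[where K = "1/2"]) (auto simp: sums_iff)
  moreover have "(\<Sum>n. diffs (psi_coeff M) n * 0 ^ n) = mom M 1"
    by (simp add: diffs_def psi_coeff_def)
  ultimately have "((\<lambda>z. \<Sum>n. psi_coeff M n * z ^ n) has_field_derivative mom M 1) (at 0)" by simp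
  then show ?thesis
    by (rule has_field_derivative_transform_within_open[where S = "ball 0 1"])
      (use psiT_power_series[OF M] in \<open>auto simp: sums_iff\<close>)
qed

text \<open>Since w / (1 - w) = ((1 + w) / (1 - w) - 1) / 2, this is half the Poisson kernel minus
  1/2.\<close>

lemma Re_herglotz_kernel:
  assumes "norm w < 1"
  shows "Re (w / (1 - w)) = (1 - (norm w)\<^sup>2) / (2 * (norm (1 - w))\<^sup>2) - 1 / 2"
proof -
  have "1 - w \<noteq> 0" using assms by auto
  then have nz: "(norm (1 - w))\<^sup>2 \<noteq> 0" by simp
  have "Re (w / (1 - w)) = Re (w * cnj (1 - w)) / (norm (1 - w))\<^sup>2"
    by (simp only: complex_div_cnj[of w] Re_divide_of_real of_real_power[symmetric])
  also have "Re (w * cnj (1 - w)) = (1 - (norm w)\<^sup>2) / 2 - (norm (1 - w))\<^sup>2 / 2"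
    unfolding cmod_power2 by (simp add: power2_eq_square field_simps)
  finally show ?thesis using nz by (simp add: field_simps)
qed

lemma Re_psiT_gt:
  assumes M: "probT M" and z: "norm z < 1"
  shows "Re (psiT M z) > - 1 / 2"
proof -
  interpret prob_space M using M by (rule probT_prob_space)
  \<comment> \<open>A margin uniform over the circle, so that the inequality stays strict after
    integration; 8 is twice the bound 4 for the squared norm of 1 - z * x.\<close>
  define \<delta> where "\<delta> = (1 - norm z) / 8"
  have bound: "Re (z * x / (1 - z * x)) \<ge> \<delta> - 1 / 2" if "norm x = 1" for x
  proof -
    have zx: "norm (z * x) = norm z" using that by (simp add: norm_mult)
    have "1 - z * x \<noteq> 0" using zx z by auto
    then have pos: "(norm (1 - z * x))\<^sup>2 > 0" by simp
    have "norm (1 - z * x) \<le> 2" using norm_triangle_ineq4[of 1 "z * x"] zx z by simp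
    then have "(norm (1 - z * x))\<^sup>2 \<le> 2\<^sup>2" by (intro power_mono) auto
    then have "(1 - norm z) / (2 * 4) \<le> (1 - norm z) / (2 * (norm (1 - z * x))\<^sup>2)"
      using pos z by (intro divide_left_mono) auto
    also have "\<dots> \<le> (1 - (norm z)\<^sup>2) / (2 * (norm (1 - z * x))\<^sup>2)"
      using z by (intro divide_right_mono) (auto simp: power2_eq_square mult_left_le_one_le)
    finally show ?thesis using Re_herglotz_kernel[of "z * x"] zx z by (simp add: \<delta>_def)
  qed
  have int: "integrable M (\<lambda>x. z * x / (1 - z * x))"
  proof (rule probT_integrable[OF M])
    fix x :: complex assume "norm x = 1"
    then have zx: "norm (z * x) = norm z" by (simp add: norm_mult)
    then have "norm (1 - z * x) \<ge> 1 - norm z" using norm_triangle_ineq2[of 1 "z * x"] by simp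
    then show "norm (z * x / (1 - z * x)) \<le> norm z / (1 - norm z)"
      using z unfolding norm_divide zx by (intro divide_left_mono mult_pos_pos) auto
  qed measurable
  have "Re (psiT M z) = (\<integral>x. Re (z * x / (1 - z * x)) \<partial>M)"
    unfolding psiT_def using int by (rule integral_Re[symmetric])
  also have "\<dots> \<ge> \<delta> - 1 / 2"
  proof (rule integral_ge_const)
    show "AE x in M. \<delta> - 1 / 2 \<le> Re (z * x / (1 - z * x))"
      using probT_AE[OF M] by eventually_elim (rule bound)
  qed (use int in simp)
  finally have "\<delta> - 1 / 2 \<le> Re (psiT M z)" .
  moreover have "\<delta> > 0" using z by (simp add: \<delta>_def)
  ultimately show ?thesis by linarith
qed

lemma one_plus_psiT_nonzero: "probT M \<Longrightarrow> norm z < 1 \<Longrightarrow> 1 + psiT M z \<noteq> 0"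
  using Re_psiT_gt[of M z] by (auto simp: complex_eq_iff)

text \<open>The map w / (1 + w) sends the half-plane Re w > -1/2 into the unit disc.\<close>

lemma etaT_norm_less_1:
  assumes "probT M" "norm z < 1"
  shows "norm (etaT M z) < 1"
proof -
  have "(norm (psiT M z))\<^sup>2 < (norm (1 + psiT M z))\<^sup>2"
    using Re_psiT_gt[OF assms] unfolding cmod_power2 by (simp add: power2_eq_square algebra_simps)
  then have "norm (psiT M z) < norm (1 + psiT M z)" by (rule power2_less_imp_less) simp
  then show ?thesis
    using one_plus_psiT_nonzero[OF assms] by (simp add: etaT_def norm_divide)
qed

lemma psiT_eq_etaT:
  assumes "probT M" "norm z < 1"
  shows "psiT M z = etaT M z / (1 - etaT M z)"
  using one_plus_psiT_nonzero[OF assms] by (simp add: etaT_def divide_simps)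

lemma etaT_0 [simp]: "etaT M 0 = 0"
  by (simp add: etaT_def)

lemma etaT_holo: "probT M \<Longrightarrow> etaT M holomorphic_on ball 0 1"
  unfolding etaT_def[abs_def] using psiT_holo[of M] one_plus_psiT_nonzero[of M]
  by (intro holomorphic_intros) auto

lemma etaT_deriv_0:
  assumes M: "probT M"
  shows "deriv (etaT M) 0 = mom M 1"
proof -
  have "(etaT M has_field_derivative mom M 1) (at 0)"
    unfolding etaT_def[abs_def]
    using DERIV_divide[OF psiT_deriv_0[OF M] DERIV_add[OF DERIV_const[of 1] psiT_deriv_0[OF M]]] by simp
  then show ?thesis by (rule DERIV_imp_deriv)
qed

lemma hT_0: "probT M \<Longrightarrow> hT M 0 = mom M 1"
  by (simp add: hT_def etaT_deriv_0)

lemma etaT_eq_hT: "etaT M z = z * hT M z"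
  by (simp add: hT_def)

lemma schur_hT:
  assumes M: "probT M"
  shows "schur (hT M)"
proof -
  have "(\<lambda>z. if z = 0 then deriv (etaT M) 0 else (etaT M z - etaT M 0) / (z - 0)) holomorphic_on ball 0 1"
    by (rule pole_lemma_open[OF etaT_holo[OF M] open_ball])
  then have "hT M holomorphic_on ball 0 1" by (rule holomorphic_transform) (simp add: hT_def)
  moreover have "norm (hT M z) \<le> 1" if "norm z < 1" for z
  proof (cases "z = 0")
    case True
    then show ?thesis using mom_norm_le[OF M] by (simp add: hT_0[OF M])
  next
    case False
    have "norm (etaT M z) \<le> norm z"
      by (rule Schwarz_Lemma[OF etaT_holo[OF M]]) (use that etaT_norm_less_1[OF M] in auto)
    then show ?thesis using False by (simp add: hT_def norm_divide)
  qed
  ultimately show ?thesis by (auto simp: schur_def)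
qed

text \<open>At 0 the equation itself says nothing, but there both functions are the derivative of
  eta.\<close>

lemma hT_unique:
  assumes p: "schur p" and eq: "\<And>z. norm z < 1 \<Longrightarrow> etaT M z = z * p z" and z: "norm z < 1"
  shows "hT M z = p z"
proof (cases "z = 0")
  case True
  have "(p has_field_derivative deriv p 0) (at 0)"
    by (rule holomorphic_derivI[OF schur_holo[OF p]]) auto
  then have "((\<lambda>z. z * p z) has_field_derivative p 0) (at 0)"
    using DERIV_mult[OF DERIV_ident, of p "deriv p 0" 0 UNIV] by simp
  then have "(etaT M has_field_derivative p 0) (at 0)"
    by (rule has_field_derivative_transform_within_open[where S = "ball 0 1"]) (use eq in auto)
  then show ?thesis using True by (simp add: hT_def DERIV_imp_deriv)
next
  case False
  then show ?thesis using eq[OF z] by (simp add: hT_def)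
qed

lemma probT_dirac1: "probT dirac1"
  by (simp add: probT_def dirac1_def prob_space_return emeasure_return)

lemma etaT_dirac1:
  assumes "norm z < 1"
  shows "etaT dirac1 z = z"
proof -
  have "psiT dirac1 z = z / (1 - z)"
    unfolding psiT_def dirac1_def by (subst integral_return) auto
  moreover have "1 - z \<noteq> 0" using assms by auto
  then have "1 + z / (1 - z) = 1 / (1 - z)" by (simp add: field_simps)
  ultimately show ?thesis using \<open>1 - z \<noteq> 0\<close> by (simp add: etaT_def)
qed

lemma hT_dirac1: "norm z < 1 \<Longrightarrow> hT dirac1 z = 1"
  using hT_unique[of "\<lambda>_. 1" dirac1 z] by (simp add: schur_const etaT_dirac1)

section \<open>Herglotz representation\<close>

abbreviation unif :: "real measure" where
  "unif \<equiv> uniform_measure lborel {0..<2 * pi}"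

lemma prob_space_unif: "prob_space unif"
  by (rule prob_space_uniform_measure) auto

lemma unif_integrable:
  fixes f :: "real \<Rightarrow> 'a::{banach, second_countable_topology}"
  assumes "f \<in> borel_measurable borel" "\<And>x. norm (f x) \<le> B"
  shows "integrable unif f"
proof -
  interpret prob_space unif by (rule prob_space_unif)
  show ?thesis using assms by (intro integrable_const_bound[of _ B]) auto
qed

lemma integral_unif:
  fixes f :: "real \<Rightarrow> 'a::{banach, second_countable_topology}"
  assumes [measurable]: "f \<in> borel_measurable borel"
  shows "integral\<^sup>L unif f = (1 / (2 * pi)) *\<^sub>R (\<integral>x. indicator {0..2 * pi} x *\<^sub>R f x \<partial>lborel)"
proof -
  have "unif = density lborel (\<lambda>x. ennreal (indicator {0..<2 * pi} x / (2 * pi)))"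
    unfolding uniform_measure_def
    by (intro density_cong) (auto split: split_indicator simp: ennreal_1[symmetric] divide_ennreal simp del: ennreal_1)
  then have "integral\<^sup>L unif f = (\<integral>x. (indicator {0..<2 * pi} x / (2 * pi)) *\<^sub>R f x \<partial>lborel)"
    by (simp only:) (rule integral_density, auto)
  also have "\<dots> = (\<integral>x. (1 / (2 * pi)) *\<^sub>R (indicator {0..2 * pi} x *\<^sub>R f x) \<partial>lborel)"
  proof (rule integral_cong_AE)
    show "AE x in lborel. (indicator {0..<2 * pi} x / (2 * pi)) *\<^sub>R f x =
        (1 / (2 * pi)) *\<^sub>R (indicator {0..2 * pi} x *\<^sub>R f x)"
      using AE_lborel_singleton[of "2 * pi"] by eventually_elim (auto split: split_indicator)
  qed measurable
  finally show ?thesis by (simp only: integral_scaleR_right)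
qed

lemma borel_measurable_cis [measurable]: "cis \<in> borel_measurable borel"
  by (intro borel_measurable_continuous_onI continuous_intros)

lemma integral_cis_unif: "(\<integral>x. cis (of_int m * x) \<partial>unif) = (if m = 0 then 1 else 0)"
proof (cases "m = 0")
  case True
  interpret prob_space unif by (rule prob_space_unif)
  show ?thesis using True prob_space by simp
next
  case False
  let ?F = "\<lambda>x::real. cis (of_int m * x) / (\<i> * of_int m)"
  have "(\<integral>x. indicator {0..2 * pi} x *\<^sub>R cis (of_int m * x) \<partial>lborel) = ?F (2 * pi) - ?F 0"
  proof (rule integral_FTC_Icc)
    show "(?F has_vector_derivative cis (of_int m * x)) (at x within {0..2 * pi})" for x
    proof -
      have "((\<lambda>x. exp (\<i> * of_real (of_int m * x)) / (\<i> * of_int m)) has_vector_derivative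
          exp (\<i> * of_real (of_int m * x))) (at x within {0..2 * pi})"
        using False by (auto intro!: derivative_eq_intros has_vector_derivative_real_field simp: field_simps)
      then show ?thesis by (simp add: cis_conv_exp)
    qed
    show "continuous_on {0..2 * pi} (\<lambda>x. cis (real_of_int m * x))" by (intro continuous_intros)
  qed auto
  moreover have meas: "(\<lambda>x. cis (of_int m * x)) \<in> borel_measurable borel"
    by (intro borel_measurable_continuous_onI continuous_intros)
  moreover have "cis (of_int m * (2 * pi)) = 1"
    using cis_multiple_2pi[of "of_int m"] by (simp add: mult.commute mult.left_commute)
  ultimately show ?thesis using False by (subst integral_unif[OF meas]) auto
qed

text \<open>Measures on the circle are obtained from laws of an angle on the line, where tightness
  yields weak limits.\<close>

lemma probT_distr_cis:
  assumes "real_distribution N"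
  shows "probT (distr N borel cis)" "mom (distr N borel cis) k = (\<integral>x. cis (real k * x) \<partial>N)"
proof -
  interpret real_distribution N by fact
  have "(cis -` sphere 0 1 \<inter> space N) = space N" by auto
  then have "emeasure (distr N borel cis) (sphere 0 1) = 1"
    by (subst emeasure_distr) (use emeasure_space_1 in auto)
  then show "probT (distr N borel cis)"
    by (simp add: probT_def prob_space_distr)
  show "mom (distr N borel cis) k = (\<integral>x. cis (real k * x) \<partial>N)"
    unfolding mom_def by (subst integral_distr) (auto simp: Complex.DeMoivre)
qed

lemma haarT_properties: "probT haarT" "k > 0 \<Longrightarrow> mom haarT k = 0"
proof -
  interpret prob_space unif by (rule prob_space_unif)
  have "real_distribution unif" by unfold_locales simp
  from probT_distr_cis[OF this] show "probT haarT" "k > 0 \<Longrightarrow> mom haarT k = 0"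
    using integral_cis_unif[of "int k"] by (simp_all add: haarT_def)
qed

text \<open>With e(z) = z p(z), the function e / (1 - e) has real part at least -1/2. Hence 1 plus
  twice this real part is a nonnegative density on each circle of radius r < 1, and its Fourier
  coefficients are the Taylor coefficients times r^k. A weak limit for r tending to 1 has the Taylor
  coefficients themselves as moments.\<close>

theorem herglotz_representation:
  assumes p: "schur p"
  obtains M where "probT M" "\<And>z. norm z < 1 \<Longrightarrow> etaT M z = z * p z"
proof -
  define e where "e z = z * p z" for z
  have e1: "norm (e z) < 1" if "norm z < 1" for z using schur_norm_less(2)[OF p that] by (simp add: e_def)
  have e2: "1 - e z \<noteq> 0" if "norm z < 1" for z using e1[OF that] by auto
  define \<psi> where "\<psi> z = e z / (1 - e z)" for z
  have holo: "\<psi> holomorphic_on ball 0 1"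
    unfolding \<psi>_def[abs_def] using e2 schur_holo[OF p]
    by (intro holomorphic_intros) (auto simp: e_def[abs_def] intro!: holomorphic_intros)
  define a where "a n = (deriv ^^ n) \<psi> 0 / fact n" for n
  have ser: "(\<lambda>n. a n * z ^ n) sums \<psi> z" if "norm z < 1" for z
    using holomorphic_power_series[OF holo, of z] that by (simp add: a_def)
  have a0: "a 0 = 0" by (simp add: a_def \<psi>_def e_def)
  \<comment> \<open>The angle is -x so that integration against \<open>cis (real k * x)\<close>
    produces \<open>a k\<close> and not its conjugate.\<close>
  define D where "D r x = 1 + 2 * Re (\<psi> (of_real r * cis (- x)))" for r x
  have mom_r: "integrable unif (D r)" "(\<integral>x. D r x \<partial>unif) = 1" "\<And>x. 0 \<le> D r x" "D r \<in> borel_measurable borel"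
    "\<And>k. k > 0 \<Longrightarrow> (\<integral>x. D r x *\<^sub>R cis (real k * x) \<partial>unif) = a k * of_real r ^ k"
    if r: "0 \<le> r" "r < 1" for r
  proof -
    have nr: "norm (of_real r * cis (- x)) < 1" for x using r by (simp add: norm_mult)
    let ?\<psi> = "\<lambda>x. \<psi> (of_real r * cis (- x))"
    have cont: "continuous_on UNIV ?\<psi>"
      by (rule continuous_on_compose2[OF holomorphic_on_imp_continuous_on[OF holo]])
        (use nr in \<open>auto intro!: continuous_intros\<close>)
    have [measurable]: "?\<psi> \<in> borel_measurable borel"
      using cont by (rule borel_measurable_continuous_onI)
    show D_meas: "D r \<in> borel_measurable borel" unfolding D_def by measurable
    show "0 \<le> D r x" for x
    proof -
      have "Re (?\<psi> x) \<ge> - 1 / 2"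
        using Re_herglotz_kernel[OF e1[OF nr[of x]]] e1[OF nr[of x]]
        by (simp add: \<psi>_def power_le_one)
      then show ?thesis by (simp add: D_def)
    qed
    have "norm (of_real r :: complex) < norm (of_real ((1 + r) / 2) :: complex)"
      "norm (of_real ((1 + r) / 2) :: complex) < 1"
      using r by (simp_all only: norm_of_real) auto
    then have summ: "summable (\<lambda>n. norm (a n * of_real r ^ n))"
      using powser_insidea[OF sums_summable[OF ser]] by blast
    have term_eq: "cis (of_int k * x) * (a n * (of_real r * cis (- x)) ^ n) =
        a n * of_real r ^ n * cis (of_int (k - int n) * x)" for k :: int and n x
    proof -
      have "cis (of_int k * x) * cis (- x) ^ n = cis (of_int (k - int n) * x)"
        by (simp add: Complex.DeMoivre cis_mult algebra_simps)
      then show ?thesis by (simp add: power_mult_distrib mult_ac)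
    qed
    \<comment> \<open>Negative k serve the conjugate term in \<open>D_eq\<close>, which therefore
      contributes nothing to moments of positive order.\<close>
    have fourier: "integrable unif (\<lambda>x. cis (of_int k * x) * ?\<psi> x)"
      "(\<integral>x. cis (of_int k * x) * ?\<psi> x \<partial>unif) = (if 0 \<le> k then a (nat k) * of_real r ^ nat k else 0)"
      for k :: int
    proof -
      let ?f = "\<lambda>n x. a n * of_real r ^ n * cis (of_int (k - int n) * x)"
      have f_int: "integrable unif (?f n)" for n
        by (rule unif_integrable[where B = "norm (a n * of_real r ^ n)"]) (auto simp: norm_mult)
      have f_norm: "norm (?f n x) = norm (a n * of_real r ^ n)" for n x by (simp add: norm_mult)
      have AE_summ: "AE x in unif. summable (\<lambda>n. norm (?f n x))" unfolding f_norm using summ by simp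
      interpret prob_space unif by (rule prob_space_unif)
      have int_summ: "summable (\<lambda>n. \<integral>x. norm (?f n x) \<partial>unif)"
        unfolding f_norm using summ prob_space by simp
      have "(\<lambda>n. cis (of_int k * x) * (a n * (of_real r * cis (- x)) ^ n)) sums (cis (of_int k * x) * ?\<psi> x)" for x
        by (intro sums_mult ser nr)
      then have suminf_eq: "(\<lambda>x. \<Sum>n. ?f n x) = (\<lambda>x. cis (of_int k * x) * ?\<psi> x)"
        unfolding term_eq by (auto simp: sums_iff)
      show "integrable unif (\<lambda>x. cis (of_int k * x) * ?\<psi> x)"
        using integrable_suminf[OF f_int AE_summ int_summ] unfolding suminf_eq .
      have 1: "(\<lambda>n. \<integral>x. ?f n x \<partial>unif) sums (\<integral>x. cis (of_int k * x) * ?\<psi> x \<partial>unif)"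
        using sums_integral[OF f_int AE_summ int_summ] unfolding suminf_eq .
      have f_val: "(\<integral>x. ?f n x \<partial>unif) = (if k = int n then a n * of_real r ^ n else 0)" for n
        by (subst integral_mult_right_zero) (simp add: integral_cis_unif del: of_int_diff)
      show "(\<integral>x. cis (of_int k * x) * ?\<psi> x \<partial>unif) = (if 0 \<le> k then a (nat k) * of_real r ^ nat k else 0)"
      proof (cases "0 \<le> k")
        case True
        then have "(\<lambda>n. \<integral>x. ?f n x \<partial>unif) = (\<lambda>n. if n = nat k then a n * of_real r ^ n else 0)"
          unfolding f_val by auto
        then have "(\<lambda>n. \<integral>x. ?f n x \<partial>unif) sums (a (nat k) * of_real r ^ nat k)"
          using sums_single[of "nat k" "\<lambda>n. a n * of_real r ^ n"] by simp
        with 1 show ?thesis using True by (simp add: sums_unique2)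
      next
        case False
        then have "(\<lambda>n. \<integral>x. ?f n x \<partial>unif) = (\<lambda>n. 0)" unfolding f_val by auto
        with 1 have "(\<lambda>n::nat. 0) sums (\<integral>x. cis (of_int k * x) * ?\<psi> x \<partial>unif)" by simp
        then show ?thesis using False sums_unique2[OF _ sums_zero] by simp
      qed
    qed
    have D_eq: "of_real (D r x) * cis (of_int k * x) =
        cis (of_int k * x) + cis (of_int k * x) * ?\<psi> x + cnj (cis (of_int (- k) * x) * ?\<psi> x)" for k :: int and x
    proof -
      have "of_real (D r x) = 1 + ?\<psi> x + cnj (?\<psi> x)"
        by (simp add: D_def complex_eq_iff)
      moreover have "cnj (cis (of_int (- k) * x)) = cis (of_int k * x)" by (simp add: cis_cnj)
      ultimately show ?thesis by (simp add: algebra_simps)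
    qed
    have cis_int: "integrable unif (\<lambda>x. cis (of_int k * x))" for k
      by (rule unif_integrable[where B = 1]) auto
    have D_int: "integrable unif (\<lambda>x. of_real (D r x) * cis (of_int k * x))" for k
      unfolding D_eq by (intro Bochner_Integration.integrable_add integrable_cnj cis_int fourier)
    have D_val: "(\<integral>x. of_real (D r x) * cis (of_int k * x) \<partial>unif) =
       (if k = 0 then 1 else a (nat k) * of_real r ^ nat k)" if "k \<ge> 0" for k
    proof -
      have "(\<integral>x. of_real (D r x) * cis (of_int k * x) \<partial>unif) = (\<integral>x. cis (of_int k * x) \<partial>unif) +
          (\<integral>x. cis (of_int k * x) * ?\<psi> x \<partial>unif) + cnj (\<integral>x. cis (of_int (- k) * x) * ?\<psi> x \<partial>unif)"
        unfolding D_eq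
        using Bochner_Integration.integral_add[OF Bochner_Integration.integrable_add[OF cis_int fourier(1)]
            integrable_cnj[OF fourier(1)], of k k "- k"]
          Bochner_Integration.integral_add[OF cis_int fourier(1), of k k]
        by (simp only: Bochner_Integration.integral_cnj)
      then show ?thesis using that unfolding fourier(2) integral_cis_unif by (simp add: a0)
    qed
    show "integrable unif (D r)"
      using integrable_Re[OF D_int[of 0]] by simp
    have "complex_of_real (\<integral>x. D r x \<partial>unif) = 1"
      using D_val[of 0] by simp
    then show "(\<integral>x. D r x \<partial>unif) = 1" by (simp only: of_real_eq_1_iff)
    show "(\<integral>x. D r x *\<^sub>R cis (real k * x) \<partial>unif) = a k * of_real r ^ k" if "k > 0" for k
      using D_val[of "int k"] that by (simp add: scaleR_conv_of_real)
  qed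
  define R where "R j = real (Suc j) / real (Suc (Suc j))" for j
  have R: "0 \<le> R j" "R j < 1" for j by (auto simp: R_def)
  have R_lim: "R \<longlonglongrightarrow> 1"
    unfolding R_def using LIMSEQ_Suc[OF LIMSEQ_n_over_Suc_n] by simp
  define N where "N j = density unif (\<lambda>x. ennreal (D (R j) x))" for j
  have N_dist: "real_distribution (N j)" for j
  proof -
    note m = mom_r[OF R[of j]]
    have "emeasure (N j) (space (N j)) = (\<integral>\<^sup>+x. ennreal (D (R j) x) \<partial>unif)"
      unfolding N_def using m(4) by (subst emeasure_density) (auto intro!: nn_integral_cong)
    also have "\<dots> = 1" using m(1,2,3) by (subst nn_integral_eq_integral) auto
    finally have "prob_space (N j)" by (rule prob_spaceI)
    then show ?thesis by (intro real_distribution.intro real_distribution_axioms.intro) (auto simp: N_def)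
  qed
  have N_mom: "(\<integral>x. cis (real k * x) \<partial>N j) = a k * of_real (R j) ^ k" if "k > 0" for j k
    unfolding N_def using mom_r(3,4)[OF R[of j]] mom_r(5)[OF R[of j] that]
    by (subst integral_density) auto
  \<comment> \<open>An interval of the half-open shape in \<open>tight\<close>; it contains all
    angles, as 8 exceeds 2 pi.\<close>
  have N_supp: "measure (N j) {-1<..8} = 1" for j
  proof -
    interpret real_distribution "N j" by (rule N_dist)
    have "AE x in unif. x \<in> {-1<..8}"
      using pi_less_4 by (intro AE_uniform_measureI AE_I2) auto
    then have "AE x in N j. x \<in> {-1<..8}"
      unfolding N_def using mom_r(4)[OF R[of j]] by (subst AE_density) auto
    then show ?thesis by (subst prob_eq_1) auto
  qed
  have "tight N"
    unfolding tight_def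
  proof (intro conjI allI impI N_dist)
    fix \<epsilon> :: real assume "\<epsilon> > 0"
    then have "\<forall>j. 1 - \<epsilon> < measure (N j) {-1<..8}" by (simp add: N_supp)
    then show "\<exists>a b. a < b \<and> (\<forall>j. 1 - \<epsilon> < measure (N j) {a<..b})"
      by (intro exI[of _ "-1"] exI[of _ "8"]) simp
  qed
  from tight_imp_convergent_subsubsequence[OF this strict_mono_id]
  obtain s M where s: "strict_mono (s :: nat \<Rightarrow> nat)" and M: "real_distribution M" "weak_conv_m (N \<circ> s) M"
    by (auto simp only: comp_id)
  have M_mom: "(\<integral>x. cis (real k * x) \<partial>M) = a k" if k: "k > 0" for k
  proof -
    have "continuous_on UNIV (\<lambda>x. cis (real k * x))" by (intro continuous_intros)
    then have isc: "isCont (\<lambda>x. cis (real k * x)) x" for x by (simp add: continuous_on_eq_continuous_at)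
    have "(\<lambda>j. \<integral>x. cis (real k * x) \<partial>(N \<circ> s) j) \<longlonglongrightarrow> (\<integral>x. cis (real k * x) \<partial>M)"
      by (rule weak_conv_imp_integral_bdd_continuous_conv[OF _ M isc, where B = 1])
        (use N_dist in auto)
    then have "(\<lambda>j. a k * of_real (R (s j)) ^ k) \<longlonglongrightarrow> (\<integral>x. cis (real k * x) \<partial>M)"
      by (simp add: N_mom[OF k])
    moreover have "(\<lambda>j. a k * of_real (R (s j)) ^ k) \<longlonglongrightarrow> a k * of_real 1 ^ k"
      using LIMSEQ_subseq_LIMSEQ[OF R_lim s] by (intro tendsto_intros) (simp add: o_def)
    ultimately show ?thesis using LIMSEQ_unique by fastforce
  qed
  let ?M = "distr M borel cis"
  note M' = probT_distr_cis[OF M(1)]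
  have "etaT ?M z = z * p z" if z: "norm z < 1" for z
  proof -
    have "psi_coeff ?M n = a n" for n
      by (simp add: psi_coeff_def M'(2) M_mom a0)
    then have "psiT ?M z = \<psi> z"
      using psiT_power_series[OF M'(1) z] ser[OF z] by (simp add: sums_unique2)
    moreover have "1 + \<psi> z = 1 / (1 - e z)" using e2[OF z] by (simp add: \<psi>_def field_simps)
    ultimately show ?thesis using e2[OF z] by (simp add: etaT_def \<psi>_def e_def)
  qed
  with M'(1) show ?thesis using that by blast
qed

section \<open>Weak convergence\<close>

text \<open>Powers of \<open>cnj x\<close> stand for negative powers of x, with which they agree on
  the circle, and keep the functions continuous on the whole plane.\<close>

inductive trig_poly :: "(complex \<Rightarrow> complex) \<Rightarrow> bool" where
  monom: "trig_poly (\<lambda>x. c * x ^ m * cnj x ^ n)"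
| add: "trig_poly f \<Longrightarrow> trig_poly g \<Longrightarrow> trig_poly (\<lambda>x. f x + g x)"

lemma trig_poly_monom_mult:
  assumes "trig_poly g"
  shows "trig_poly (\<lambda>x. c * x ^ m * cnj x ^ n * g x)"
  using assms
proof induction
  case (monom d k l)
  have "(\<lambda>x. c * x ^ m * cnj x ^ n * (d * x ^ k * cnj x ^ l)) = (\<lambda>x. (c * d) * x ^ (m + k) * cnj x ^ (n + l))"
    by (auto simp: power_add mult_ac)
  then show ?case by (simp only: trig_poly.monom)
qed (simp add: distrib_left trig_poly.add)

lemma trig_poly_mult: "trig_poly f \<Longrightarrow> trig_poly g \<Longrightarrow> trig_poly (\<lambda>x. f x * g x)"
  by (induction rule: trig_poly.induct) (simp_all add: trig_poly_monom_mult distrib_right trig_poly.add)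

lemma trig_poly_continuous: "trig_poly f \<Longrightarrow> continuous_on UNIV f"
  by (induction rule: trig_poly.induct) (auto intro!: continuous_intros)

text \<open>Real Stone--Weierstrass for the trigonometric polynomials with real values;
  \<open>Re\<close> and \<open>Im\<close> are among them and separate points.\<close>

lemma trig_poly_dense:
  assumes "continuous_on (sphere 0 1) f" "e > 0"
  obtains g where "trig_poly (\<lambda>x. of_real (g x))" "\<And>x. norm x = 1 \<Longrightarrow> \<bar>f x - g x :: real\<bar> < e"
proof -
  let ?P = "\<lambda>g :: complex \<Rightarrow> real. trig_poly (\<lambda>x. of_real (g x))"
  have const: "?P (\<lambda>x. c)" for c
    using trig_poly.monom[of "of_real c" 0 0] by simp
  have re: "?P Re"
  proof -
    have "(\<lambda>x. of_real (Re x)) = (\<lambda>x. (1/2) * x ^ 1 * cnj x ^ 0 + (1/2) * x ^ 0 * cnj x ^ 1)"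
      by (auto simp: complex_eq_iff)
    then show ?thesis by (simp only: trig_poly.intros)
  qed
  have im: "?P Im"
  proof -
    have "(\<lambda>x. of_real (Im x)) = (\<lambda>x. (- \<i> / 2) * x ^ 1 * cnj x ^ 0 + (\<i> / 2) * x ^ 0 * cnj x ^ 1)"
      by (auto simp: complex_eq_iff)
    then show ?thesis by (simp only: trig_poly.intros)
  qed
  have "\<exists>g. ?P g \<and> (\<forall>x\<in>sphere 0 1. \<bar>f x - g x\<bar> < e)"
  proof (rule Stone_Weierstrass_HOL[OF _ _ _ _ _ _ assms])
    show "continuous_on (sphere 0 1) g" if "?P g" for g
      using continuous_on_subset[OF continuous_on_Re[OF trig_poly_continuous[OF that]]] by simp
    show "\<exists>g. ?P g \<and> g x \<noteq> g y" if "x \<in> sphere 0 1 \<and> y \<in> sphere 0 1 \<and> x \<noteq> y" for x y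
      using that re im by (metis complex_eqI)
  qed (use const trig_poly.add trig_poly_mult in auto)
  then show ?thesis using that by auto
qed

lemma probT_integrable_continuous:
  fixes f :: "complex \<Rightarrow> 'a::{banach, second_countable_topology}"
  assumes "probT M" "continuous_on UNIV f"
  shows "integrable M f"
proof -
  have "compact (f ` sphere 0 1)"
    using assms(2) by (intro compact_continuous_image) (auto intro: continuous_on_subset)
  then obtain B where "\<And>x. norm x = 1 \<Longrightarrow> norm (f x) \<le> B"
    using compact_imp_bounded bounded_iff by (metis image_eqI mem_sphere_0)
  then show ?thesis
    using assms by (intro probT_integrable) (auto intro: borel_measurable_continuous_onI)
qed

lemma integral_trig_monom:
  assumes M: "probT M"
  shows "(\<integral>x. c * x ^ m * cnj x ^ n \<partial>M) = c * (if n \<le> m then mom M (m - n) else cnj (mom M (n - m)))"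
proof -
  have [measurable]: "(\<lambda>x. x) \<in> borel_measurable M"
    using probT_sets[OF M] by (rule measurable_ident_sets)
  have circ: "x ^ m * cnj x ^ n = (if n \<le> m then x ^ (m - n) else cnj (x ^ (n - m)))" if "norm x = 1" for x :: complex
  proof -
    have 1: "(x * cnj x) ^ k = 1" for k
      using that by (simp add: complex_norm_square[symmetric])
    show ?thesis
    proof (cases "n \<le> m")
      case True
      have "x ^ m * cnj x ^ n = x ^ (m - n) * (x * cnj x) ^ n"
        using True by (simp add: power_mult_distrib flip: mult.assoc power_add)
      then show ?thesis using True 1 by simp
    next
      case False
      have "x ^ m * cnj x ^ n = cnj x ^ (n - m) * (x * cnj x) ^ m"
        using False by (simp add: power_mult_distrib mult_ac flip: power_add)
      then show ?thesis using False 1 by simp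
    qed
  qed
  have "(\<integral>x. x ^ m * cnj x ^ n \<partial>M) = (\<integral>x. (if n \<le> m then x ^ (m - n) else cnj (x ^ (n - m))) \<partial>M)"
  proof (rule integral_cong_AE)
    show "AE x in M. x ^ m * cnj x ^ n = (if n \<le> m then x ^ (m - n) else cnj (x ^ (n - m)))"
      using probT_AE[OF M] by eventually_elim (rule circ)
    show "(\<lambda>x. x ^ m * cnj x ^ n) \<in> borel_measurable M"
      by (intro borel_measurable_integrable probT_integrable_continuous[OF M] continuous_intros)
    show "(\<lambda>x. if n \<le> m then x ^ (m - n) else cnj (x ^ (n - m))) \<in> borel_measurable M"
      by (intro borel_measurable_integrable probT_integrable_continuous[OF M])
        (cases "n \<le> m"; auto intro!: continuous_intros)
  qed
  also have "\<dots> = (if n \<le> m then mom M (m - n) else cnj (mom M (n - m)))"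
    by (simp add: mom_def del: complex_cnj_power)
  finally show ?thesis by (simp add: mult.assoc)
qed

lemma weak_convergence_of_moments:
  fixes Mt :: "'i \<Rightarrow> complex measure" and f :: "complex \<Rightarrow> real"
  assumes Mt: "\<And>i. probT (Mt i)" and M: "probT M"
    and lim: "\<And>k. ((\<lambda>i. mom (Mt i) k) \<longlongrightarrow> mom M k) F"
    and f: "continuous_on UNIV f"
  shows "((\<lambda>i. \<integral>x. f x \<partial>Mt i) \<longlongrightarrow> (\<integral>x. f x \<partial>M)) F"
proof (rule tendstoI)
  have trig: "((\<lambda>i. \<integral>x. g x \<partial>Mt i) \<longlongrightarrow> (\<integral>x. g x \<partial>M)) F" if "trig_poly g" for g
    using that
  proof induction
    case (monom c m n)
    then show ?case
      unfolding integral_trig_monom[OF Mt] integral_trig_monom[OF M]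
      using lim by (cases "n \<le> m") (auto intro!: tendsto_intros)
  next
    case (add g h)
    note int = probT_integrable_continuous[OF _ trig_poly_continuous[OF add.hyps(1)]]
      probT_integrable_continuous[OF _ trig_poly_continuous[OF add.hyps(2)]]
    show ?case
      using add.IH int[OF Mt] int[OF M] by (simp add: tendsto_add)
  qed
  fix \<epsilon> :: real assume \<epsilon>: "\<epsilon> > 0"
  have fs: "continuous_on (sphere 0 1) f" using f by (rule continuous_on_subset) simp
  obtain g where g: "trig_poly (\<lambda>x. of_real (g x))" "\<And>x. norm x = 1 \<Longrightarrow> \<bar>f x - g x\<bar> < \<epsilon> / 3"
    by (rule trig_poly_dense[OF fs, of "\<epsilon> / 3"]) (use \<epsilon> in auto)
  have gc: "continuous_on UNIV g"
    using continuous_on_Re[OF trig_poly_continuous[OF g(1)]] by simp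
  have close: "\<bar>(\<integral>x. f x \<partial>N) - (\<integral>x. g x \<partial>N)\<bar> \<le> \<epsilon> / 3" if N: "probT N" for N
  proof -
    have "(\<integral>x. f x \<partial>N) - (\<integral>x. g x \<partial>N) = (\<integral>x. f x - g x \<partial>N)"
      using probT_integrable_continuous[OF N f] probT_integrable_continuous[OF N gc] by simp
    also have "norm \<dots> \<le> \<epsilon> / 3"
      using g(2) f gc
      by (intro probT_integral_norm_le[OF N] borel_measurable_continuous_onI continuous_intros)
        (auto intro: less_imp_le)
    finally show ?thesis by simp
  qed
  have "((\<lambda>i. complex_of_real (\<integral>x. g x \<partial>Mt i)) \<longlongrightarrow> of_real (\<integral>x. g x \<partial>M)) F"
    using trig[OF g(1)] by simp
  then have "((\<lambda>i. \<integral>x. g x \<partial>Mt i) \<longlongrightarrow> (\<integral>x. g x \<partial>M)) F"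
    by (simp only: tendsto_of_real_iff)
  then have "\<forall>\<^sub>F i in F. dist (\<integral>x. g x \<partial>Mt i) (\<integral>x. g x \<partial>M) < \<epsilon> / 3"
    using \<epsilon> by (intro tendstoD) auto
  then show "\<forall>\<^sub>F i in F. dist (\<integral>x. f x \<partial>Mt i) (\<integral>x. f x \<partial>M) < \<epsilon>"
  proof eventually_elim
    case (elim i)
    then show ?case using close[OF Mt[of i]] close[OF M] unfolding dist_real_def by linarith
  qed
qed

text \<open>The shifted series satisfy T_n(z) = c_n + z T_(n+1)(z). As the coefficients are
  uniformly bounded, a small z makes the last term small for all i, so convergence of T_n to 0
  forces that of c_n. Dividing by z then gives it for T_(n+1) at every nonzero z, and induction
  continues.\<close>

lemma power_series_coeff_tendsto_0:
  fixes c :: "'i \<Rightarrow> nat \<Rightarrow> complex"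
  assumes B: "\<And>i n. norm (c i n) \<le> B"
    and lim: "\<And>z. norm z < 1 \<Longrightarrow> z \<noteq> 0 \<Longrightarrow> ((\<lambda>i. \<Sum>n. c i n * z ^ n) \<longlongrightarrow> 0) F"
  shows "((\<lambda>i. c i n) \<longlongrightarrow> 0) F"
proof -
  have summ: "summable (\<lambda>m. c i (n + m) * z ^ m)" if "norm z < 1" for i n z
  proof (rule summable_comparison_test')
    show "summable (\<lambda>m. B * norm z ^ m)" using that by (intro summable_mult summable_geometric) auto
    show "norm (c i (n + m) * z ^ m) \<le> B * norm z ^ m" for m
      using B by (simp add: norm_mult norm_power mult_right_mono)
  qed
  have split: "(\<Sum>m. c i (n + m) * z ^ m) = c i n + z * (\<Sum>m. c i (Suc n + m) * z ^ m)" if "norm z < 1" for i n z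
    using suminf_split_head[OF summ[OF that, of i n]] suminf_mult[OF summ[OF that, of i "Suc n"], of z]
    by (simp add: algebra_simps)
  have step: "((\<lambda>i. c i n) \<longlongrightarrow> 0) F"
    if T: "\<And>z. norm z < 1 \<Longrightarrow> z \<noteq> 0 \<Longrightarrow> ((\<lambda>i. \<Sum>m. c i (n + m) * z ^ m) \<longlongrightarrow> 0) F" for n
  proof (rule tendstoI)
    fix e :: real assume e: "e > 0"
    have B1: "\<bar>B\<bar> + 1 > 0" by simp
    \<comment> \<open>With x <= 1/2 the tail is at most 2 (|B| + 1); the other bound limits its
      contribution to e/2.\<close>
    define x where "x = min (1/2) (e / (4 * (\<bar>B\<bar> + 1)))"
    have x: "0 < x" "x \<le> 1/2" using e unfolding x_def by (simp, intro min.cobounded1)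
    have "x * (\<bar>B\<bar> + 1) \<le> e / (4 * (\<bar>B\<bar> + 1)) * (\<bar>B\<bar> + 1)" unfolding x_def by (intro mult_right_mono) auto
    also have "\<dots> = e / 4" by (simp add: field_simps)
    finally have xB: "x * (\<bar>B\<bar> + 1) \<le> e / 4" .
    let ?z = "complex_of_real x"
    have z: "norm ?z < 1" "?z \<noteq> 0" using x by auto
    have tail: "norm (\<Sum>m. c i (Suc n + m) * ?z ^ m) \<le> 2 * (\<bar>B\<bar> + 1)" for i
    proof -
      have s: "summable (\<lambda>m. (\<bar>B\<bar> + 1) * (1/2::real) ^ m)" by (intro summable_mult summable_geometric) auto
      have le: "norm (c i (Suc n + m) * ?z ^ m) \<le> (\<bar>B\<bar> + 1) * (1/2::real) ^ m" for m
        using B[of i "Suc n + m"] x unfolding norm_mult norm_power by (intro mult_mono power_mono) auto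
      have "norm (\<Sum>m. c i (Suc n + m) * ?z ^ m) \<le> (\<Sum>m. (\<bar>B\<bar> + 1) * (1/2::real) ^ m)"
        by (rule norm_suminf_le[OF le s])
      also have "\<dots> = 2 * (\<bar>B\<bar> + 1)" by (subst suminf_mult) (auto simp: suminf_geometric)
      finally show ?thesis .
    qed
    have "\<forall>\<^sub>F i in F. dist (\<Sum>m. c i (n + m) * ?z ^ m) 0 < e / 4"
      using T[OF z] e by (intro tendstoD) auto
    then show "\<forall>\<^sub>F i in F. dist (c i n) 0 < e"
    proof eventually_elim
      case (elim i)
      have "norm (c i n) = norm ((\<Sum>m. c i (n + m) * ?z ^ m) - ?z * (\<Sum>m. c i (Suc n + m) * ?z ^ m))"
        using split[OF z(1), of i n] by simp
      also have "\<dots> \<le> norm (\<Sum>m. c i (n + m) * ?z ^ m) + norm (?z * (\<Sum>m. c i (Suc n + m) * ?z ^ m))"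
        by (rule norm_triangle_ineq4)
      also have "norm (?z * (\<Sum>m. c i (Suc n + m) * ?z ^ m)) \<le> x * (2 * (\<bar>B\<bar> + 1))"
        using tail[of i] x unfolding norm_mult by (intro mult_mono) auto
      finally show ?case using elim xB e by (simp add: algebra_simps)
    qed
  qed
  have "((\<lambda>i. \<Sum>m. c i (n + m) * z ^ m) \<longlongrightarrow> 0) F" if "norm z < 1" "z \<noteq> 0" for z
    using that
  proof (induction n arbitrary: z)
    case 0
    then show ?case using lim by simp
  next
    case (Suc n)
    have "((\<lambda>i. ((\<Sum>m. c i (n + m) * z ^ m) - c i n) / z) \<longlongrightarrow> (0 - 0) / z) F"
      by (intro tendsto_intros Suc step) (use Suc in auto)
    moreover have "((\<Sum>m. c i (n + m) * z ^ m) - c i n) / z = (\<Sum>m. c i (Suc n + m) * z ^ m)" for i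
      using split[OF Suc.prems(1), of i n] Suc.prems by simp
    ultimately show ?case by simp
  qed
  then show ?thesis by (rule step)
qed

text \<open>As eta has modulus below 1, psi = eta / (1 - eta) converges as well, and its Taylor
  coefficients are the moments. Order 0 is separate because psi does not see it.\<close>

lemma moments_tendsto_of_etaT:
  assumes Mt: "\<And>i. probT (Mt i)" and M: "probT M"
    and lim: "\<And>z. norm z < 1 \<Longrightarrow> ((\<lambda>i. etaT (Mt i) z) \<longlongrightarrow> etaT M z) F"
  shows "((\<lambda>i. mom (Mt i) k) \<longlongrightarrow> mom M k) F"
proof (cases "k = 0")
  case True
  have "mom N 0 = 1" if "probT N" for N
    using prob_space.prob_space[OF probT_prob_space[OF that]] by (simp add: mom_def)
  then show ?thesis using True Mt M by simp
next
  case False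
  have psi: "((\<lambda>i. psiT (Mt i) z) \<longlongrightarrow> psiT M z) F" if z: "norm z < 1" for z
  proof -
    have "1 - etaT M z \<noteq> 0" using etaT_norm_less_1[OF M z] by auto
    then show ?thesis
      unfolding psiT_eq_etaT[OF Mt z] psiT_eq_etaT[OF M z] by (intro tendsto_intros lim z)
  qed
  have "((\<lambda>i. psi_coeff (Mt i) k - psi_coeff M k) \<longlongrightarrow> 0) F"
  proof (rule power_series_coeff_tendsto_0[where B = 2])
    have b: "norm (psi_coeff N n) \<le> 1" if "probT N" for N n
      using mom_norm_le[OF that] by (simp add: psi_coeff_def)
    show "norm (psi_coeff (Mt i) n - psi_coeff M n) \<le> 2" for i n
      using norm_triangle_ineq4[of "psi_coeff (Mt i) n" "psi_coeff M n"] b[OF Mt[of i], of n] b[OF M, of n] by linarith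
    fix z :: complex assume z: "norm z < 1"
    have "(\<Sum>n. (psi_coeff (Mt i) n - psi_coeff M n) * z ^ n) = psiT (Mt i) z - psiT M z" for i
      using sums_diff[OF psiT_power_series[OF Mt z] psiT_power_series[OF M z]]
      by (simp add: sums_iff left_diff_distrib)
    then show "((\<lambda>i. \<Sum>n. (psi_coeff (Mt i) n - psi_coeff M n) * z ^ n) \<longlongrightarrow> 0) F"
      using psi[OF z] by (simp only: Lim_null[of _ "psiT M z"])
  qed
  then show ?thesis using False by (simp only: psi_coeff_def if_False Lim_null[of _ "mom M k"])
qed

lemma weakly_continuous_of_etaT:
  assumes M: "\<And>t. 0 \<le> t \<Longrightarrow> probT (M t)"
    and cont: "\<And>z. norm z < 1 \<Longrightarrow> continuous_on {0..} (\<lambda>t. etaT (M t) z)"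
  shows "weakly_continuous M"
  unfolding weakly_continuous_def
proof (intro allI impI)
  fix f :: "complex \<Rightarrow> real" assume f: "continuous_on UNIV f \<and> bounded (range f)"
  show "continuous_on {0..} (\<lambda>t. \<integral>x. f x \<partial>M t)"
    unfolding continuous_on_sequentially
  proof (intro ballI allI impI)
    fix X :: "nat \<Rightarrow> real" and t assume t: "t \<in> {0..}" and X: "(\<forall>n. X n \<in> {0..}) \<and> X \<longlonglongrightarrow> t"
    have "(\<lambda>n. \<integral>x. f x \<partial>M (X n)) \<longlonglongrightarrow> (\<integral>x. f x \<partial>M t)"
    proof (intro weak_convergence_of_moments moments_tendsto_of_etaT)
      show "(\<lambda>n. etaT (M (X n)) z) \<longlonglongrightarrow> etaT (M t) z" if "norm z < 1" for z
        using cont[OF that] X t unfolding continuous_on_sequentially by (auto simp: o_def)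
    qed (use M X t f in auto)
    then show "((\<lambda>t. \<integral>x. f x \<partial>M t) \<circ> X) \<longlonglongrightarrow> (\<integral>x. f x \<partial>M t)" by (simp add: o_def)
  qed
qed

text \<open>Equal eta transforms make the constant sequence M converge weakly to N, so continuous
  functions have equal integrals. Indicators of closed sets are limits of such functions from
  above.\<close>

lemma probT_eqI:
  assumes M: "probT M" and N: "probT N"
    and eq: "\<And>z. norm z < 1 \<Longrightarrow> etaT M z = etaT N z"
  shows "M = N"
proof -
  have int_eq: "(\<integral>x. f x \<partial>M) = (\<integral>x. f x \<partial>N)" if "continuous_on UNIV f" for f :: "complex \<Rightarrow> real"
  proof -
    have "(\<lambda>n::nat. \<integral>x. f x \<partial>M) \<longlonglongrightarrow> (\<integral>x. f x \<partial>N)"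
      using eq by (intro weak_convergence_of_moments moments_tendsto_of_etaT M N that) auto
    then show ?thesis by (simp add: LIMSEQ_const_iff)
  qed
  have lim: "(\<lambda>n. \<integral>x. max 0 (1 - real n * infdist x C) \<partial>L) \<longlonglongrightarrow> measure L C"
    if C: "closed C" "C \<noteq> {}" and L: "probT L" for C and L :: "complex measure"
  proof -
    interpret prob_space L using L by (rule probT_prob_space)
    have C_sets: "C \<in> sets L" using C probT_sets[OF L] by auto
    have cont: "continuous_on UNIV (\<lambda>x. max 0 (1 - real n * infdist x C))" for n
      by (intro continuous_intros)
    have "(\<lambda>n. \<integral>x. max 0 (1 - real n * infdist x C) \<partial>L) \<longlonglongrightarrow> (\<integral>x. indicator C x \<partial>L)"
    proof (rule integral_dominated_convergence[where w = "\<lambda>_. 1"])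
      show "(indicator C :: complex \<Rightarrow> real) \<in> borel_measurable L" using C_sets by simp
      show "(\<lambda>x. max 0 (1 - real n * infdist x C)) \<in> borel_measurable L" for n
        using probT_integrable_continuous[OF L cont] by (rule borel_measurable_integrable)
      show "AE x in L. (\<lambda>n. max 0 (1 - real n * infdist x C)) \<longlonglongrightarrow> indicator C x"
      proof (rule AE_I2)
        fix x
        show "(\<lambda>n. max 0 (1 - real n * infdist x C)) \<longlonglongrightarrow> indicator C x"
        proof (cases "x \<in> C")
          case False
          then have d: "infdist x C > 0"
            using C by (metis in_closed_iff_infdist_zero infdist_nonneg less_eq_real_def)
          obtain k :: nat where "1 / infdist x C < real k" using reals_Archimedean2 by blast
          then have "max 0 (1 - real n * infdist x C) = 0" if "n \<ge> k" for n
            using d that by (simp add: field_simps max_def) (smt (verit) mult_right_mono of_nat_mono)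
          then have "\<forall>\<^sub>F n in sequentially. max 0 (1 - real n * infdist x C) = indicator C x"
            using False by (intro eventually_sequentiallyI[of k]) auto
          then show ?thesis by (rule tendsto_eventually)
        qed simp
      qed
      show "AE x in L. norm (max 0 (1 - real n * infdist x C)) \<le> 1" for n
        by (intro AE_I2) (auto simp: infdist_nonneg)
    qed simp
    then show ?thesis using C_sets by simp
  qed
  show ?thesis
  proof (rule measure_eqI_generator_eq[where E = "Collect closed" and \<Omega> = UNIV and A = "\<lambda>_. UNIV"])
    show "emeasure M C = emeasure N C" if "C \<in> Collect closed" for C
    \<comment> \<open>The distance to the empty set is 0 by convention, so there the approximants
      would be 1 everywhere.\<close>
    proof (cases "C = {}")
      case False
      have "measure M C = measure N C"
      proof (rule LIMSEQ_unique)
        have C: "closed C" using that by simp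
        show "(\<lambda>n. \<integral>x. max 0 (1 - real n * infdist x C) \<partial>M) \<longlonglongrightarrow> measure M C"
          by (rule lim[OF C False M])
        have "(\<integral>x. max 0 (1 - real n * infdist x C) \<partial>M) = (\<integral>x. max 0 (1 - real n * infdist x C) \<partial>N)" for n
          by (intro int_eq continuous_intros)
        then show "(\<lambda>n. \<integral>x. max 0 (1 - real n * infdist x C) \<partial>M) \<longlonglongrightarrow> measure N C"
          using lim[OF C False N] by simp
      qed
      then show ?thesis
        using M N by (simp add: probT_def prob_space_def finite_measure.emeasure_eq_measure)
    qed simp
    show "sets M = sigma_sets UNIV (Collect closed)" "sets N = sigma_sets UNIV (Collect closed)"
      using M N by (simp_all add: probT_def borel_eq_closed)
    show "emeasure M UNIV \<noteq> \<infinity>" for i :: nat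
      using M by (simp add: probT_def prob_space_def finite_measure.emeasure_finite)
  qed (auto simp: Int_stable_def)
qed

section \<open>The embedding theorem\<close>

lemma cm_conv_hT:
  assumes c: "cm_conv p1 p2 p" and z: "norm z < 1"
  shows "hT (snd p) z = hT (snd p2) z * hT (snd p1) (z * hT (snd p2) z)"
    "hT (fst p) z = hT (fst p2) z * hT (fst p1) (z * hT (snd p2) z)"
proof -
  have pr: "probT (fst p1)" "probT (snd p1)" "probT (fst p2)" "probT (snd p2)"
    using c by (auto simp: cm_conv_def)
  have sch: "schur (\<lambda>z. hT M z * hT N (z * hT (snd p2) z))" if "probT M" "probT N" for M N
    using schur_mult[OF schur_hT[OF that(1)] schur_compose_funpow[OF schur_hT[OF pr(4)] schur_hT[OF that(2)], of 1]]
    by simp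
  have eq: "etaT (snd p) z = z * (hT (snd p2) z * hT (snd p1) (z * hT (snd p2) z))"
    "etaT (fst p) z = z * (hT (fst p2) z * hT (fst p1) (z * hT (snd p2) z))" if "norm z < 1" for z
    using c that unfolding cm_conv_def by (simp_all add: etaT_eq_hT mult.assoc)
  show "hT (snd p) z = hT (snd p2) z * hT (snd p1) (z * hT (snd p2) z)"
    by (rule hT_unique[OF sch[OF pr(4,2)] eq(1) z])
  show "hT (fst p) z = hT (fst p2) z * hT (fst p1) (z * hT (snd p2) z)"
    by (rule hT_unique[OF sch[OF pr(3,1)] eq(2) z])
qed

text \<open>In \<open>cm_pow_Suc\<close> the new factor stands on the right and acts first, which
  matches splitting off the first factor of the cocycle in \<open>cocycle_Suc\<close>.\<close>

lemma cm_pow_hT: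
  assumes "cm_pow n p r" "norm z < 1" "probT (snd p)"
  shows "hT (snd r) z = cocycle (\<lambda>z. z * hT (snd p) z) (hT (snd p)) n z \<and>
         hT (fst r) z = cocycle (\<lambda>z. z * hT (snd p) z) (hT (fst p)) n z"
  using assms
proof (induction arbitrary: z rule: cm_pow.induct)
  case (cm_pow_0 p)
  then show ?case by (simp add: hT_dirac1)
next
  case (cm_pow_Suc n p q r)
  have "norm (z * hT (snd p) z) < 1"
    by (rule schur_norm_less(2)[OF schur_hT[OF cm_pow_Suc.prems(2)] cm_pow_Suc.prems(1)])
  from cm_pow_Suc.IH[OF this cm_pow_Suc.prems(2)] show ?case
    using cm_conv_hT[OF cm_pow_Suc.hyps(2) cm_pow_Suc.prems(1)] by (simp add: cocycle_Suc)
qed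

text \<open>All moments of positive order of the Haar measure vanish, so its eta transform is 0, and
  eta determines the measure.\<close>

lemma hT_nonzero_of_not_haarT:
  assumes "probT M" "M \<noteq> haarT"
  obtains z where "norm z < 1" "hT M z \<noteq> 0"
proof -
  have "psiT haarT z = 0" if "norm z < 1" for z
  proof -
    have "psi_coeff haarT n = 0" for n by (simp add: psi_coeff_def haarT_properties(2))
    then show ?thesis using psiT_power_series[OF haarT_properties(1) that] by (simp add: sums_iff)
  qed
  then have "etaT haarT z = 0" if "norm z < 1" for z using that by (simp add: etaT_def)
  then have "\<exists>z. norm z < 1 \<and> hT M z \<noteq> 0"
    using probT_eqI[OF assms(1) haarT_properties(1)] assms(2) etaT_eq_hT[of M] by auto
  then show ?thesis using that by blast
qed

lemma measures_of_schur_family: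
  assumes M: "probT M" and P: "\<And>t. 0 \<le> t \<Longrightarrow> schur (P t)"
    and P01: "\<And>z. norm z < 1 \<Longrightarrow> P 0 z = 1" "\<And>z. norm z < 1 \<Longrightarrow> P 1 z = hT M z"
  obtains Mt :: "real \<Rightarrow> complex measure" where "Mt 0 = dirac1" "Mt 1 = M" "\<And>t. 0 \<le> t \<Longrightarrow> probT (Mt t)"
    "\<And>t z. 0 \<le> t \<Longrightarrow> norm z < 1 \<Longrightarrow> etaT (Mt t) z = z * P t z"
    "\<And>t z. 0 \<le> t \<Longrightarrow> norm z < 1 \<Longrightarrow> hT (Mt t) z = P t z"
proof -
  have "\<exists>N. probT N \<and> (\<forall>z. norm z < 1 \<longrightarrow> etaT N z = z * P t z)" if "0 \<le> t" for t
    using herglotz_representation[OF P[OF that]] by metis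
  then obtain Nt where Nt: "\<And>t. 0 \<le> t \<Longrightarrow> probT (Nt t) \<and> (\<forall>z. norm z < 1 \<longrightarrow> etaT (Nt t) z = z * P t z)"
    by metis
  \<comment> \<open>The chosen measures are overwritten at times 0 and 1, so the two prescribed
    values hold by definition; this is consistent because \<open>P 0\<close> and \<open>P 1\<close>
    are the transforms of \<open>dirac1\<close> and \<open>M\<close>.\<close>
  define Mt where "Mt t = (if t = 0 then dirac1 else if t = 1 then M else Nt t)" for t :: real
  have 1: "probT (Mt t)" if "0 \<le> t" for t
    using Nt[OF that] M probT_dirac1 by (simp add: Mt_def)
  have 2: "etaT (Mt t) z = z * P t z" if "0 \<le> t" "norm z < 1" for t z
    using Nt[OF that(1)] that P01 by (simp add: Mt_def etaT_dirac1 etaT_eq_hT[of M])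
  have 3: "hT (Mt t) z = P t z" if "0 \<le> t" "norm z < 1" for t z
    by (rule hT_unique[OF P[OF that(1)] 2[OF that(1)] that(2)])
  show ?thesis by (rule that[of Mt]) (simp_all add: 1 2 3, simp_all add: Mt_def)
qed

lemma weakly_continuous_Re_mom:
  assumes M: "\<And>t. 0 \<le> t \<Longrightarrow> probT (M t)" and cont: "weakly_continuous M"
  shows "continuous_on {0..} (\<lambda>t. Re (mom (M t) 1))"
proof -
  \<comment> \<open>\<open>Re\<close> is unbounded on the plane; truncation makes it an admissible
    test function and changes nothing on the circle.\<close>
  let ?f = "\<lambda>x. max (- 1) (min 1 (Re x))"
  have "bounded (range ?f)" unfolding bounded_iff by (intro exI[of _ 1]) auto
  then have c: "continuous_on {0..} (\<lambda>t. \<integral>x. ?f x \<partial>M t)"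
    using cont unfolding weakly_continuous_def
    by (elim allE[of _ ?f] impE) (auto intro!: continuous_intros)
  have eq: "(\<integral>x. ?f x \<partial>M t) = Re (mom (M t) 1)" if t: "0 \<le> t" for t
  proof -
    have int: "integrable (M t) (\<lambda>x. x)"
      by (rule probT_integrable_continuous[OF M[OF t]]) (intro continuous_intros)
    have "(\<integral>x. ?f x \<partial>M t) = (\<integral>x. Re x \<partial>M t)"
    proof (rule integral_cong_AE)
      show "AE x in M t. ?f x = Re x"
        using probT_AE[OF M[OF t]]
      proof eventually_elim
        case (elim x)
        then show ?case using abs_Re_le_cmod[of x] by (simp add: abs_le_iff)
      qed
      show "?f \<in> borel_measurable (M t)"
        by (intro borel_measurable_integrable probT_integrable_continuous[OF M[OF t]] continuous_intros)
    qed (use int in auto)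
    also have "\<dots> = Re (mom (M t) 1)" using int by (simp add: mom_def integral_Re)
    finally show ?thesis .
  qed
  show ?thesis by (rule continuous_on_eq[OF c]) (use eq in auto)
qed

lemma first_moment_nonzero:
  assumes M: "\<And>t. 0 \<le> t \<Longrightarrow> probT (M t)" and cont: "weakly_continuous M" and M0: "M 0 = dirac1"
    and pow: "\<And>n. 0 < n \<Longrightarrow> hT (M 1) 0 = hT (M (1 / real n)) 0 ^ n"
  shows "M 1 \<noteq> haarT"
proof
  assume M1: "M 1 = haarT"
  have zero: "mom (M (1 / real (Suc n))) 1 = 0" for n
  proof -
    have "hT (M 1) 0 = 0" using hT_0[OF haarT_properties(1)] haarT_properties(2)[of 1] by (simp add: M1)
    then have "hT (M (1 / real (Suc n))) 0 = 0" using pow[of "Suc n"] by (metis power_eq_0_iff zero_less_Suc)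
    then show ?thesis using hT_0[OF M, of "1 / real (Suc n)"] by simp
  qed
  have "(\<lambda>n. Re (mom (M (1 / real (Suc n))) 1)) \<longlonglongrightarrow> Re (mom (M 0) 1)"
    by (rule continuous_on_tendsto_compose[OF weakly_continuous_Re_mom[OF M cont] LIMSEQ_Suc[OF lim_1_over_n]]) auto
  then have "Re (mom (M 0) 1) = 0" unfolding zero by (simp add: LIMSEQ_const_iff)
  moreover have "mom (M 0) 1 = 1"
    using hT_0[OF probT_dirac1] hT_dirac1[of 0] by (simp add: M0)
  ultimately show False by simp
qed

theorem theorem5p3:
  fixes \<mu> \<nu> :: "complex measure"
  assumes "probT \<mu>" and "probT \<nu>"
  shows "(cm_inf_div \<mu> \<nu> \<and> \<mu> \<noteq> haarT \<and> \<nu> \<noteq> haarT) \<longleftrightarrow>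
         (\<exists>\<mu>t \<nu>t. cm_semigroup \<mu>t \<nu>t \<and> \<mu>t 0 = dirac1 \<and> \<nu>t 0 = dirac1
                 \<and> \<mu>t 1 = \<mu> \<and> \<nu>t 1 = \<nu>)"
proof
  assume L: "cm_inf_div \<mu> \<nu> \<and> \<mu> \<noteq> haarT \<and> \<nu> \<noteq> haarT"
  have roots: "\<exists>q g. is_root (hT \<nu>) (hT \<mu>) n q g" if n: "2 \<le> n" for n
  proof -
    obtain \<mu>n \<nu>n where d: "probT \<mu>n" "probT \<nu>n" "cm_pow n (\<mu>n, \<nu>n) (\<mu>, \<nu>)"
      using L n unfolding cm_inf_div_def by blast
    then have "is_root (hT \<nu>) (hT \<mu>) n (hT \<nu>n) (hT \<mu>n)"
      using cm_pow_hT[OF d(3)] by (simp add: is_root_def schur_hT)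
    then show ?thesis by blast
  qed
  obtain z1 z2 where nz: "norm z1 < 1" "hT \<nu> z1 \<noteq> 0" "norm z2 < 1" "hT \<mu> z2 \<noteq> 0"
    using hT_nonzero_of_not_haarT[OF assms(1)] hT_nonzero_of_not_haarT[OF assms(2)] L by metis
  obtain P H where PH: "schur_semigroup P H"
      "\<And>z. norm z < 1 \<Longrightarrow> P 1 z = hT \<nu> z" "\<And>z. norm z < 1 \<Longrightarrow> H 1 z = hT \<mu> z"
    by (rule schur_semigroup_embedding[OF schur_hT[OF assms(2)] schur_hT[OF assms(1)] roots nz]) blast+
  have sg: "\<And>t. 0 \<le> t \<Longrightarrow> schur (P t)" "\<And>t. 0 \<le> t \<Longrightarrow> schur (H t)"
    "\<And>z. norm z < 1 \<Longrightarrow> P 0 z = 1" "\<And>z. norm z < 1 \<Longrightarrow> H 0 z = 1"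
    "\<And>s t z. 0 \<le> s \<Longrightarrow> 0 \<le> t \<Longrightarrow> norm z < 1 \<Longrightarrow> P (s + t) z = P t z * P s (z * P t z)"
    "\<And>s t z. 0 \<le> s \<Longrightarrow> 0 \<le> t \<Longrightarrow> norm z < 1 \<Longrightarrow> H (s + t) z = H t z * H s (z * P t z)"
    "\<And>z. norm z < 1 \<Longrightarrow> continuous_on {0..} (\<lambda>t. P t z)"
    "\<And>z. norm z < 1 \<Longrightarrow> continuous_on {0..} (\<lambda>t. H t z)"
    using PH(1) by (auto simp: schur_semigroup_def)
  obtain \<nu>t where \<nu>t: "\<nu>t 0 = dirac1" "\<nu>t 1 = \<nu>" "\<And>t. 0 \<le> t \<Longrightarrow> probT (\<nu>t t)"
    "\<And>t z. 0 \<le> t \<Longrightarrow> norm z < 1 \<Longrightarrow> etaT (\<nu>t t) z = z * P t z"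
    "\<And>t z. 0 \<le> t \<Longrightarrow> norm z < 1 \<Longrightarrow> hT (\<nu>t t) z = P t z"
    by (rule measures_of_schur_family[OF assms(2) sg(1) sg(3) PH(2)]) blast+
  obtain \<mu>t where \<mu>t: "\<mu>t 0 = dirac1" "\<mu>t 1 = \<mu>" "\<And>t. 0 \<le> t \<Longrightarrow> probT (\<mu>t t)"
    "\<And>t z. 0 \<le> t \<Longrightarrow> norm z < 1 \<Longrightarrow> etaT (\<mu>t t) z = z * H t z"
    "\<And>t z. 0 \<le> t \<Longrightarrow> norm z < 1 \<Longrightarrow> hT (\<mu>t t) z = H t z"
    by (rule measures_of_schur_family[OF assms(1) sg(2) sg(4) PH(3)]) blast+
  have "cm_conv (\<mu>t s, \<nu>t s) (\<mu>t t, \<nu>t t) (\<mu>t (s + t), \<nu>t (s + t))" if st: "0 \<le> s" "0 \<le> t" for s t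
  proof -
    have "etaT (\<nu>t (s + t)) z = etaT (\<nu>t s) (etaT (\<nu>t t) z) \<and>
        etaT (\<mu>t (s + t)) z = etaT (\<mu>t t) z * hT (\<mu>t s) (etaT (\<nu>t t) z)" if z: "norm z < 1" for z
    proof -
      have "norm (z * P t z) < 1" by (rule schur_norm_less(2)[OF sg(1)[OF st(2)] z])
      then show ?thesis using st z by (simp add: \<nu>t(4) \<mu>t(4,5) sg(5,6) mult.assoc)
    qed
    then show ?thesis using st \<mu>t(3) \<nu>t(3) by (simp add: cm_conv_def)
  qed
  moreover have "weakly_continuous \<mu>t"
  proof (rule weakly_continuous_of_etaT[OF \<mu>t(3)])
    show "continuous_on {0..} (\<lambda>t. etaT (\<mu>t t) z)" if z: "norm z < 1" for z
      by (rule continuous_on_eq[OF continuous_on_mult[OF continuous_on_const[of _ z] sg(8)[OF z]]])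
        (use z in \<open>simp add: \<mu>t(4)\<close>)
  qed
  moreover have "weakly_continuous \<nu>t"
  proof (rule weakly_continuous_of_etaT[OF \<nu>t(3)])
    show "continuous_on {0..} (\<lambda>t. etaT (\<nu>t t) z)" if z: "norm z < 1" for z
      by (rule continuous_on_eq[OF continuous_on_mult[OF continuous_on_const[of _ z] sg(7)[OF z]]])
        (use z in \<open>simp add: \<nu>t(4)\<close>)
  qed
  ultimately have "cm_semigroup \<mu>t \<nu>t" using \<mu>t(3) \<nu>t(3) by (simp add: cm_semigroup_def)
  then show "\<exists>\<mu>t \<nu>t. cm_semigroup \<mu>t \<nu>t \<and> \<mu>t 0 = dirac1 \<and> \<nu>t 0 = dirac1 \<and> \<mu>t 1 = \<mu> \<and> \<nu>t 1 = \<nu>"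
    using \<mu>t(1,2) \<nu>t(1,2) by blast
next
  assume "\<exists>\<mu>t \<nu>t. cm_semigroup \<mu>t \<nu>t \<and> \<mu>t 0 = dirac1 \<and> \<nu>t 0 = dirac1 \<and> \<mu>t 1 = \<mu> \<and> \<nu>t 1 = \<nu>"
  then obtain \<mu>t \<nu>t where sg: "cm_semigroup \<mu>t \<nu>t" and ends: "\<mu>t 0 = dirac1" "\<nu>t 0 = dirac1" "\<mu>t 1 = \<mu>" "\<nu>t 1 = \<nu>"
    by blast
  have pr: "probT (\<mu>t t)" "probT (\<nu>t t)" if "0 \<le> t" for t using sg that by (auto simp: cm_semigroup_def)
  have conv: "cm_conv (\<mu>t s, \<nu>t s) (\<mu>t t, \<nu>t t) (\<mu>t (s + t), \<nu>t (s + t))" if "0 \<le> s" "0 \<le> t" for s t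
    using sg that by (auto simp: cm_semigroup_def)
  have wc: "weakly_continuous \<mu>t" "weakly_continuous \<nu>t" using sg by (auto simp: cm_semigroup_def)
  have pow: "cm_pow k (\<mu>t t, \<nu>t t) (\<mu>t (real k * t), \<nu>t (real k * t))" if t: "0 \<le> t" for k t
  proof (induction k)
    case 0
    then show ?case by (simp add: ends cm_pow_0)
  next
    case (Suc k)
    have "cm_conv (\<mu>t (real k * t), \<nu>t (real k * t)) (\<mu>t t, \<nu>t t) (\<mu>t (real (Suc k) * t), \<nu>t (real (Suc k) * t))"
      using conv[of "real k * t" t] t by (simp add: algebra_simps)
    with Suc show ?case by (rule cm_pow_Suc)
  qed
  have pow1: "cm_pow n (\<mu>t (1 / real n), \<nu>t (1 / real n)) (\<mu>, \<nu>)" if "0 < n" for n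
    using pow[of "1 / real n" n] that by (simp add: ends)
  have "cm_inf_div \<mu> \<nu>"
    unfolding cm_inf_div_def
  proof (intro allI impI)
    fix n :: nat assume "2 \<le> n"
    then show "\<exists>\<mu>n \<nu>n. probT \<mu>n \<and> probT \<nu>n \<and> cm_pow n (\<mu>n, \<nu>n) (\<mu>, \<nu>)"
      using pow1[of n] pr[of "1 / real n"] by (intro exI[of _ "\<mu>t (1 / real n)"] exI[of _ "\<nu>t (1 / real n)"]) simp
  qed
  \<comment> \<open>The point 0 is fixed by all the maps involved, so there the cocycle is a plain
    power, as \<open>first_moment_nonzero\<close> requires.\<close>
  moreover have "hT \<mu> 0 = hT (\<mu>t (1 / real n)) 0 ^ n" "hT \<nu> 0 = hT (\<nu>t (1 / real n)) 0 ^ n" if "0 < n" for n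
    using cm_pow_hT[OF pow1[OF that], of 0] pr[of "1 / real n"] by simp_all
  then have "\<mu> \<noteq> haarT" "\<nu> \<noteq> haarT"
    using first_moment_nonzero[OF pr(1) wc(1) ends(1)] first_moment_nonzero[OF pr(2) wc(2) ends(2)]
    by (simp_all add: ends)
  ultimately show "cm_inf_div \<mu> \<nu> \<and> \<mu> \<noteq> haarT \<and> \<nu> \<noteq> haarT" by blast
qed

end
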